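(* Let $(\mathcal C,\mathbb E,\mathfrak s)$ be an extriangulated category satisfying (WIC), with a proper class $\xi$ of $\mathbb E$-triangles having enough $\xi$-projectives and enough $\xi$-injectives. Let $\mathcal X$ be a quasi-resolving subcategory of $\mathcal C$ and $\mathcal H$ a $\xi$-cogenerator of $\mathcal X$. Then for any object $M$ with $\mathrm{res.dim}_{\mathcal X}(M)<\infty$ and any $n\ge0$, the following are equivalent: (1) $\mathrm{res.dim}_{\mathcal X}(M)\le n$. (2) There is a $\xi$-exact complex $0\to H_n\to H_{n-1}\to\cdots\to H_1\to X\to M\to0$ with $X\in\mathcal X$ and $H_i\in\mathcal H$ for $1\le i\le n$. (3) There is an $\mathbb E$-triangle $M\to W\to X\dashrightarrow$ in $\xi$ with $X\in\mathcal X$ and $\mathrm{res.dim}_{\mathcal H}(W)\le n$. (4) For every $0\le m\le n$ there is a $\xi$-exact complex $$0\to H_n\to\cdots\to H_{m+1}\to X\to P_{m-1}\to\cdots\to P_1\to P_0\to M\to0$$ with $X\in\mathcal X$, $H_i\in\mathcal H$ for $m+1\le i\le n$ and $P_j\in\mathcal P_{\mathcal X}(\xi)$ for $0\le j\le m-1$.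
   Context: Extriangulated category (Nakaoka--Palu): an additive category $\mathcal C$, a biadditive functor $\mathbb E:\mathcal C^{\mathrm{op}}\times\mathcal C\to\mathbf{Ab}$, and $\mathfrak s$, as follows. For $\delta\in\mathbb E(C,A)$, $a:A\to A'$, $c:C'\to C$ put $a_*\delta=\mathbb E(C,a)(\delta)$ and $c^*\delta=\mathbb E(c,A)(\delta)$. Sequences $A\to B\to C$ and $A\to B'\to C$ are equivalent if some isomorphism $B\to B'$ commutes with the maps from $A$ and to $C$. $\mathfrak s$ assigns to each $\delta\in\mathbb E(C,A)$ an equivalence class of sequences $A\xrightarrow{x}B\xrightarrow{y}C$; a representative is written $A\xrightarrow{x}B\xrightarrow{y}C\overset{\delta}{\dashrightarrow}$ and called an $\mathbb E$-triangle ($x$ is an inflation, $y$ a deflation; $\delta$ is often omitted). Axioms, for $\mathbb E$-triangles $A\xrightarrow{x}B\xrightarrow{y}C\overset{\delta}{\dashrightarrow}$ and $A'\xrightarrow{x'}B'\xrightarrow{y'}C'\overset{\delta'}{\dashrightarrow}$: (i) if $a:A\to A'$, $c:C\to C'$ satisfy $a_*\delta=c^*\delta'$, there is $b:B\to B'$ with $bx=x'a$, $y'b=cy$; (ii) $\mathfrak s(0)=[A\to A\oplus C\to C]$ and $\mathfrak s(\delta\oplus\delta')=\mathfrak s(\delta)\oplus\mathfrak s(\delta')$; (iii) if $a:A\to A'$, $b:B\to B'$ satisfy $bx=x'a$, there is $c:C\to C'$ with $y'b=cy$ and $a_*\delta=c^*\delta'$, and dually; (iv) given $\mathbb E$-triangles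 $A\xrightarrow{f}B\xrightarrow{f'}D\overset{\delta}{\dashrightarrow}$ and $B\xrightarrow{g}C\xrightarrow{g'}F\overset{\delta'}{\dashrightarrow}$, there are $\mathbb E$-triangles $A\xrightarrow{gf}C\xrightarrow{h'}E\overset{\delta''}{\dashrightarrow}$ and $D\xrightarrow{d}E\xrightarrow{e}F\overset{f'_*\delta'}{\dashrightarrow}$ with $h'g=df'$, $eh'=g'$, $d^*\delta''=\delta$, $f_*\delta''=e^*\delta'$, and dually. (WIC): if $gf$ is an inflation so is $f$; if $gf$ is a deflation so is $g$. Proper class: a class $\xi$ of $\mathbb E$-triangles, closed under isomorphisms and finite coproducts, containing all split $\mathbb E$-triangles ($\delta=0$), closed under base change (replacing $\delta$ by $c^*\delta$) and cobase change (replacing $\delta$ by $a_*\delta$), and saturated: given $\mathbb E$-triangles $A_1\to B_1\to C\overset{\delta_1}{\dashrightarrow}$ and $A_2\to B_2\xrightarrow{y_2}C\overset{\delta_2}{\dashrightarrow}$, if the second one and the $\mathbb E$-triangle $A_1\to M\to B_2\overset{y_2^*\delta_1}{\dashrightarrow}$ lie in $\xi$, so does the first. $P$ is $\xi$-projective if $0\to\mathcal C(P,A)\to\mathcal C(P,B)\to\mathcal C(P,C)\to0$ is exact for every $\mathbb E$-triangle $A\to B\to C\dashrightarrow$ in $\xi$; $\xi$-injectives are defined dually; $\mathcal P(\xi)$ is the class of $\xi$-projectives. Enough $\xi$-projectives (injectives): every $A$ has an $\mathbb E$-triangle $K\to P\to A\dashrightarrow$ (resp. $A\to I\to K\dashrightarrow$)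 in $\xi$ with $P$ $\xi$-projective (resp. $I$ $\xi$-injective). A complex $\cdots\to X_{n+1}\to X_n\xrightarrow{d_n}X_{n-1}\to\cdots$ is $\xi$-exact if there are $\mathbb E$-triangles $K_{n+1}\xrightarrow{g_n}X_n\xrightarrow{f_n}K_n\dashrightarrow$ in $\xi$ (its $\xi$-resolution $\mathbb E$-triangles) with $d_n=g_{n-1}f_n$ for all $n$. For a bounded complex $0\to N\to X_{n-1}\to\cdots\to X_0\to M\to0$ this means such $\mathbb E$-triangles for $0\le i\le n-1$ with $K_0=M$, $K_n=N$; similarly for one-sided complexes. Terms whose index ranges are empty are omitted. All subcategories are full and additive. An $\mathcal X$-resolution of $M$ is a $\xi$-exact complex $\cdots\to X_1\to X_0\to M\to0$ with all $X_i\in\mathcal X$; $\mathrm{res}(\mathcal X)$ is the class of objects having one. $\mathcal P_{\mathcal X}(\xi)=\mathcal X\cap\mathcal P(\xi)$. $\mathcal X$ is quasi-resolving if for every $\mathbb E$-triangle $A\to B\to C\dashrightarrow$ in $\xi$: $A,C\in\mathcal X$ implies $B\in\mathcal X$ (closed under $\xi$-extensions) and $B,C\in\mathcal X$ implies $A\in\mathcal X$ (closed under $\xi$-cocones); and $\mathcal X\subseteq\mathrm{res}(\mathcal P_{\mathcal X}(\xi))$. For a subcategory $\mathcal Y$, $\mathrm{res.dim}_{\mathcal Y}(M)$ is the least $n\ge0$ for which there is a $\xi$-exact complex $0\to Y_n\to\cdots\to Y_0\to M\to0$ with all $Y_i\in\mathcal Y$, and $\infty$ if there is none. A subcategory $\mathcal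 H\subseteq\mathcal X$ is a $\xi$-cogenerator of $\mathcal X$ if every $X\in\mathcal X$ admits an $\mathbb E$-triangle $X\to H\to X'\dashrightarrow$ in $\xi$ with $H\in\mathcal H$, $X'\in\mathcal X$. *)

theory Defs
  imports "HOL-Algebra.Exact_Sequence" "HOL-Library.Extended_Nat"
begin

section \<open>Extriangulated categories\<close>

text \<open>
  The type \<open>'o\<close> is the class of objects.  Morphism groups and extension groups are monoid records
  of HOL-Algebra, so the multiplicative symbols \<open>\<otimes>\<close> and \<open>\<one>\<close> stand for addition and zero.
  A morphism determines its source and target (see \<open>Hom_disjoint\<close> below); an extension
  need not determine its end terms, which is why they are passed along explicitly.

  \<open>Ext \<C> C A\<close> is \<open>\<bbbE>(C,A)\<close>;
  \<open>push \<C> C a = \<bbbE>(C,a)\<close>, so \<open>a\<^sub>*\<delta> = push \<C> C a \<delta>\<close> for \<open>\<delta> \<in> \<bbbE>(C,A)\<close>;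
  \<open>pull \<C> c A = \<bbbE>(c,A)\<close>, so \<open>c\<^sup>*\<delta> = pull \<C> c A \<delta>\<close> for \<open>\<delta> \<in> \<bbbE>(C,A)\<close>;
  \<open>realiz \<C> C A \<delta>\<close> is \<open>\<ss>(\<delta>)\<close> for \<open>\<delta> \<in> \<bbbE>(C,A)\<close>, a set of pairs \<open>(x, y)\<close>
  standing for sequences \<open>A \<rightarrow> B \<rightarrow> C\<close>.
\<close>

record ('o, 'm, 'e) extri =
  Hom :: "'o \<Rightarrow> 'o \<Rightarrow> 'm monoid"
  Comp :: "'m \<Rightarrow> 'm \<Rightarrow> 'm" (infixr \<open>\<cdot>\<index>\<close> 75)
  Id :: "'o \<Rightarrow> 'm"
  Ext :: "'o \<Rightarrow> 'o \<Rightarrow> 'e monoid"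
  push :: "'o \<Rightarrow> 'm \<Rightarrow> 'e \<Rightarrow> 'e"
  pull :: "'m \<Rightarrow> 'o \<Rightarrow> 'e \<Rightarrow> 'e"
  realiz :: "'o \<Rightarrow> 'o \<Rightarrow> 'e \<Rightarrow> ('m \<times> 'm) set"

abbreviation mor :: "('o, 'm, 'e) extri \<Rightarrow> 'o \<Rightarrow> 'o \<Rightarrow> 'm set" where
  "mor \<C> A B \<equiv> carrier (Hom \<C> A B)"

abbreviation ext :: "('o, 'm, 'e) extri \<Rightarrow> 'o \<Rightarrow> 'o \<Rightarrow> 'e set" where
  "ext \<C> C A \<equiv> carrier (Ext \<C> C A)"

subsection \<open>Additive categories\<close>

definition is_iso :: "('o, 'm, 'e) extri \<Rightarrow> 'o \<Rightarrow> 'o \<Rightarrow> 'm \<Rightarrow> bool" where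
  "is_iso \<C> A B f \<longleftrightarrow> f \<in> mor \<C> A B \<and>
     (\<exists>g \<in> mor \<C> B A. g \<cdot>\<^bsub>\<C>\<^esub> f = Id \<C> A \<and> f \<cdot>\<^bsub>\<C>\<^esub> g = Id \<C> B)"

definition is_zero_object :: "('o, 'm, 'e) extri \<Rightarrow> 'o \<Rightarrow> bool" where
  "is_zero_object \<C> Z \<longleftrightarrow>
     (\<forall>A. mor \<C> Z A = {\<one>\<^bsub>Hom \<C> Z A\<^esub>} \<and> mor \<C> A Z = {\<one>\<^bsub>Hom \<C> A Z\<^esub>})"

record ('o, 'm) biprod =
  sumobj :: 'o
  in1 :: 'm
  in2 :: 'm
  pr1 :: 'm
  pr2 :: 'm

definition is_biproduct :: "('o, 'm, 'e) extri \<Rightarrow> 'o \<Rightarrow> 'o \<Rightarrow> ('o, 'm) biprod \<Rightarrow> bool" where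
  "is_biproduct \<C> A B s \<longleftrightarrow>
     in1 s \<in> mor \<C> A (sumobj s) \<and> in2 s \<in> mor \<C> B (sumobj s) \<and>
     pr1 s \<in> mor \<C> (sumobj s) A \<and> pr2 s \<in> mor \<C> (sumobj s) B \<and>
     pr1 s \<cdot>\<^bsub>\<C>\<^esub> in1 s = Id \<C> A \<and> pr2 s \<cdot>\<^bsub>\<C>\<^esub> in2 s = Id \<C> B \<and>
     pr2 s \<cdot>\<^bsub>\<C>\<^esub> in1 s = \<one>\<^bsub>Hom \<C> A B\<^esub> \<and> pr1 s \<cdot>\<^bsub>\<C>\<^esub> in2 s = \<one>\<^bsub>Hom \<C> B A\<^esub> \<and>
     (in1 s \<cdot>\<^bsub>\<C>\<^esub> pr1 s) \<otimes>\<^bsub>Hom \<C> (sumobj s) (sumobj s)\<^esub> (in2 s \<cdot>\<^bsub>\<C>\<^esub> pr2 s) = Id \<C> (sumobj s)"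

locale additive_category =
  fixes \<C> :: "('o, 'm, 'e) extri" (structure)
  assumes Hom_disjoint: "f \<in> mor \<C> A B \<Longrightarrow> f \<in> mor \<C> A' B' \<Longrightarrow> A = A' \<and> B = B'"
    and Id_in_mor: "Id \<C> A \<in> mor \<C> A A"
    and Comp_in_mor: "f \<in> mor \<C> A B \<Longrightarrow> g \<in> mor \<C> B C \<Longrightarrow> g \<cdot> f \<in> mor \<C> A C"
    and Comp_assoc: "f \<in> mor \<C> A B \<Longrightarrow> g \<in> mor \<C> B C \<Longrightarrow> h \<in> mor \<C> C D \<Longrightarrow>
                       (h \<cdot> g) \<cdot> f = h \<cdot> (g \<cdot> f)"
    and Comp_Id_left: "f \<in> mor \<C> A B \<Longrightarrow> Id \<C> B \<cdot> f = f"
    and Comp_Id_right: "f \<in> mor \<C> A B \<Longrightarrow> f \<cdot> Id \<C> A = f"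
    and Hom_comm_group: "comm_group (Hom \<C> A B)"
    and Comp_hom_right: "g \<in> mor \<C> B C \<Longrightarrow> (\<lambda>f. g \<cdot> f) \<in> hom (Hom \<C> A B) (Hom \<C> A C)"
    and Comp_hom_left: "f \<in> mor \<C> A B \<Longrightarrow> (\<lambda>g. g \<cdot> f) \<in> hom (Hom \<C> B C) (Hom \<C> A C)"
    and zero_object_exists: "\<exists>Z. is_zero_object \<C> Z"
    and biproduct_exists: "\<exists>s. is_biproduct \<C> A B s"

subsection \<open>Sequences and \<open>\<bbbE>\<close>-triangles\<close>

definition seqs :: "('o, 'm, 'e) extri \<Rightarrow> 'o \<Rightarrow> 'o \<Rightarrow> ('m \<times> 'm) set" where
  "seqs \<C> A C = {(x, y). \<exists>B. x \<in> mor \<C> A B \<and> y \<in> mor \<C> B C}"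

definition seq_equiv ::
  "('o, 'm, 'e) extri \<Rightarrow> 'o \<Rightarrow> 'o \<Rightarrow> (('m \<times> 'm) \<times> ('m \<times> 'm)) set" where
  "seq_equiv \<C> A C = {((x, y), (x', y')). \<exists>B B' b.
     x \<in> mor \<C> A B \<and> y \<in> mor \<C> B C \<and> x' \<in> mor \<C> A B' \<and> y' \<in> mor \<C> B' C \<and>
     is_iso \<C> B B' b \<and> b \<cdot>\<^bsub>\<C>\<^esub> x = x' \<and> y' \<cdot>\<^bsub>\<C>\<^esub> b = y}"

text \<open>The tuple \<open>(A, x, B, y, C, \<delta>)\<close> stands for \<open>A \<rightarrow> B \<rightarrow> C\<close> with maps \<open>x\<close>, \<open>y\<close> and
  extension \<open>\<delta> \<in> \<bbbE>(C,A)\<close>.\<close>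

type_synonym ('o, 'm, 'e) etri = "'o \<times> 'm \<times> 'o \<times> 'm \<times> 'o \<times> 'e"

definition E_triangles :: "('o, 'm, 'e) extri \<Rightarrow> ('o, 'm, 'e) etri set" where
  "E_triangles \<C> = {(A, x, B, y, C, \<delta>).
     x \<in> mor \<C> A B \<and> y \<in> mor \<C> B C \<and> \<delta> \<in> ext \<C> C A \<and> (x, y) \<in> realiz \<C> C A \<delta>}"

definition inflation :: "('o, 'm, 'e) extri \<Rightarrow> 'm \<Rightarrow> bool" where
  "inflation \<C> x \<longleftrightarrow> (\<exists>A B y C \<delta>. (A, x, B, y, C, \<delta>) \<in> E_triangles \<C>)"

definition deflation :: "('o, 'm, 'e) extri \<Rightarrow> 'm \<Rightarrow> bool" where
  "deflation \<C> y \<longleftrightarrow> (\<exists>A x B C \<delta>. (A, x, B, y, C, \<delta>) \<in> E_triangles \<C>)"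

definition sum_mor ::
  "('o, 'm, 'e) extri \<Rightarrow> ('o, 'm) biprod \<Rightarrow> ('o, 'm) biprod \<Rightarrow> 'm \<Rightarrow> 'm \<Rightarrow> 'm" where
  "sum_mor \<C> s t f f' =
     (in1 t \<cdot>\<^bsub>\<C>\<^esub> f \<cdot>\<^bsub>\<C>\<^esub> pr1 s) \<otimes>\<^bsub>Hom \<C> (sumobj s) (sumobj t)\<^esub> (in2 t \<cdot>\<^bsub>\<C>\<^esub> f' \<cdot>\<^bsub>\<C>\<^esub> pr2 s)"

text \<open>For \<open>\<delta> \<in> \<bbbE>(C,A)\<close>, \<open>\<delta>' \<in> \<bbbE>(C',A')\<close> and biproducts \<open>s\<close> of \<open>A, A'\<close> and \<open>u\<close> of \<open>C, C'\<close>,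
  \<open>\<delta> \<oplus> \<delta>'\<close> is the element of \<open>\<bbbE>(C \<oplus> C', A \<oplus> A')\<close> corresponding to \<open>(\<delta>, 0, 0, \<delta>')\<close> under
  \<open>\<bbbE>(C \<oplus> C', A \<oplus> A') = \<bbbE>(C,A) \<oplus> \<bbbE>(C,A') \<oplus> \<bbbE>(C',A) \<oplus> \<bbbE>(C',A')\<close>.\<close>

definition sum_ext ::
  "('o, 'm, 'e) extri \<Rightarrow> ('o, 'm) biprod \<Rightarrow> ('o, 'm) biprod \<Rightarrow>
     'o \<Rightarrow> 'o \<Rightarrow> 'e \<Rightarrow> 'e \<Rightarrow> 'e" where
  "sum_ext \<C> u s A A' \<delta> \<delta>' =
     push \<C> (sumobj u) (in1 s) (pull \<C> (pr1 u) A \<delta>)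
       \<otimes>\<^bsub>Ext \<C> (sumobj u) (sumobj s)\<^esub>
     push \<C> (sumobj u) (in2 s) (pull \<C> (pr2 u) A' \<delta>')"

definition closed_under_sums ::
  "('o, 'm, 'e) extri \<Rightarrow> ('o, 'm, 'e) etri set \<Rightarrow> bool" where
  "closed_under_sums \<C> \<xi> \<longleftrightarrow>
     (\<forall>A x B y C \<delta> A' x' B' y' C' \<delta>' s t u.
        (A, x, B, y, C, \<delta>) \<in> \<xi> \<longrightarrow> (A', x', B', y', C', \<delta>') \<in> \<xi> \<longrightarrow>
        is_biproduct \<C> A A' s \<longrightarrow> is_biproduct \<C> B B' t \<longrightarrow> is_biproduct \<C> C C' u \<longrightarrow>
        (sumobj s, sum_mor \<C> s t x x', sumobj t, sum_mor \<C> t u y y', sumobj u,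
         sum_ext \<C> u s A A' \<delta> \<delta>') \<in> \<xi>)"

subsection \<open>Extriangulated categories\<close>

locale extriangulated_category = additive_category \<C>
  for \<C> :: "('o, 'm, 'e) extri" (structure) +
  assumes Ext_comm_group: "comm_group (Ext \<C> C A)"
    and push_hom: "a \<in> mor \<C> A A' \<Longrightarrow> push \<C> C a \<in> hom (Ext \<C> C A) (Ext \<C> C A')"
    and pull_hom: "c \<in> mor \<C> C' C \<Longrightarrow> pull \<C> c A \<in> hom (Ext \<C> C A) (Ext \<C> C' A)"
    and push_Id: "\<delta> \<in> ext \<C> C A \<Longrightarrow> push \<C> C (Id \<C> A) \<delta> = \<delta>"
    and pull_Id: "\<delta> \<in> ext \<C> C A \<Longrightarrow> pull \<C> (Id \<C> C) A \<delta> = \<delta>"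
    and push_Comp: "a \<in> mor \<C> A A' \<Longrightarrow> a' \<in> mor \<C> A' A'' \<Longrightarrow> \<delta> \<in> ext \<C> C A \<Longrightarrow>
                      push \<C> C (a' \<cdot> a) \<delta> = push \<C> C a' (push \<C> C a \<delta>)"
    and pull_Comp: "c' \<in> mor \<C> C'' C' \<Longrightarrow> c \<in> mor \<C> C' C \<Longrightarrow> \<delta> \<in> ext \<C> C A \<Longrightarrow>
                      pull \<C> (c \<cdot> c') A \<delta> = pull \<C> c' A (pull \<C> c A \<delta>)"
    and push_pull: "a \<in> mor \<C> A A' \<Longrightarrow> c \<in> mor \<C> C' C \<Longrightarrow> \<delta> \<in> ext \<C> C A \<Longrightarrow>
                      push \<C> C' a (pull \<C> c A \<delta>) = pull \<C> c A' (push \<C> C a \<delta>)"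
    and push_add: "a \<in> mor \<C> A A' \<Longrightarrow> a' \<in> mor \<C> A A' \<Longrightarrow> \<delta> \<in> ext \<C> C A \<Longrightarrow>
                     push \<C> C (a \<otimes>\<^bsub>Hom \<C> A A'\<^esub> a') \<delta> =
                       push \<C> C a \<delta> \<otimes>\<^bsub>Ext \<C> C A'\<^esub> push \<C> C a' \<delta>"
    and pull_add: "c \<in> mor \<C> C' C \<Longrightarrow> c' \<in> mor \<C> C' C \<Longrightarrow> \<delta> \<in> ext \<C> C A \<Longrightarrow>
                     pull \<C> (c \<otimes>\<^bsub>Hom \<C> C' C\<^esub> c') A \<delta> =
                       pull \<C> c A \<delta> \<otimes>\<^bsub>Ext \<C> C' A\<^esub> pull \<C> c' A \<delta>"
    and realiz_class: "\<delta> \<in> ext \<C> C A \<Longrightarrow> realiz \<C> C A \<delta> \<in> seqs \<C> A C // seq_equiv \<C> A C"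
    and realiz_mor:
      "(A, x, B, y, C, \<delta>) \<in> E_triangles \<C> \<Longrightarrow> (A', x', B', y', C', \<delta>') \<in> E_triangles \<C> \<Longrightarrow>
       a \<in> mor \<C> A A' \<Longrightarrow> c \<in> mor \<C> C C' \<Longrightarrow> push \<C> C a \<delta> = pull \<C> c A' \<delta>' \<Longrightarrow>
       \<exists>b \<in> mor \<C> B B'. b \<cdot> x = x' \<cdot> a \<and> y' \<cdot> b = c \<cdot> y"
    and realiz_zero:
      "is_biproduct \<C> A C s \<Longrightarrow> (in1 s, pr2 s) \<in> realiz \<C> C A \<one>\<^bsub>Ext \<C> C A\<^esub>"
    and realiz_sum: "closed_under_sums \<C> (E_triangles \<C>)"
    and ET3:
      "(A, x, B, y, C, \<delta>) \<in> E_triangles \<C> \<Longrightarrow> (A', x', B', y', C', \<delta>') \<in> E_triangles \<C> \<Longrightarrow>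
       a \<in> mor \<C> A A' \<Longrightarrow> b \<in> mor \<C> B B' \<Longrightarrow> b \<cdot> x = x' \<cdot> a \<Longrightarrow>
       \<exists>c \<in> mor \<C> C C'. y' \<cdot> b = c \<cdot> y \<and> push \<C> C a \<delta> = pull \<C> c A' \<delta>'"
    and ET3_op:
      "(A, x, B, y, C, \<delta>) \<in> E_triangles \<C> \<Longrightarrow> (A', x', B', y', C', \<delta>') \<in> E_triangles \<C> \<Longrightarrow>
       b \<in> mor \<C> B B' \<Longrightarrow> c \<in> mor \<C> C C' \<Longrightarrow> y' \<cdot> b = c \<cdot> y \<Longrightarrow>
       \<exists>a \<in> mor \<C> A A'. b \<cdot> x = x' \<cdot> a \<and> push \<C> C a \<delta> = pull \<C> c A' \<delta>'"
    and ET4: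
      "(A, f, B, f', D, \<delta>) \<in> E_triangles \<C> \<Longrightarrow> (B, g, C, g', F, \<delta>') \<in> E_triangles \<C> \<Longrightarrow>
       \<exists>E h' \<delta>'' d e.
         (A, g \<cdot> f, C, h', E, \<delta>'') \<in> E_triangles \<C> \<and>
         (D, d, E, e, F, push \<C> F f' \<delta>') \<in> E_triangles \<C> \<and>
         h' \<cdot> g = d \<cdot> f' \<and> e \<cdot> h' = g' \<and>
         pull \<C> d A \<delta>'' = \<delta> \<and> push \<C> E f \<delta>'' = pull \<C> e B \<delta>'"
    and ET4_op:
      "(D, f', B, f, A, \<delta>) \<in> E_triangles \<C> \<Longrightarrow> (F, g', C, g, B, \<delta>') \<in> E_triangles \<C> \<Longrightarrow>
       \<exists>E h' \<delta>'' d e.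
         (E, h', C, f \<cdot> g, A, \<delta>'') \<in> E_triangles \<C> \<and>
         (F, e, E, d, D, pull \<C> f' F \<delta>') \<in> E_triangles \<C> \<and>
         g \<cdot> h' = f' \<cdot> d \<and> h' \<cdot> e = g' \<and>
         push \<C> A d \<delta>'' = \<delta> \<and> pull \<C> f E \<delta>'' = push \<C> B e \<delta>'"

definition WIC :: "('o, 'm, 'e) extri \<Rightarrow> bool" where
  "WIC \<C> \<longleftrightarrow>
     (\<forall>A B C f g. f \<in> mor \<C> A B \<longrightarrow> g \<in> mor \<C> B C \<longrightarrow>
        (inflation \<C> (g \<cdot>\<^bsub>\<C>\<^esub> f) \<longrightarrow> inflation \<C> f) \<and>
        (deflation \<C> (g \<cdot>\<^bsub>\<C>\<^esub> f) \<longrightarrow> deflation \<C> g))"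

section \<open>Proper classes\<close>

definition etri_iso ::
  "('o, 'm, 'e) extri \<Rightarrow> ('o, 'm, 'e) etri \<Rightarrow> ('o, 'm, 'e) etri \<Rightarrow> bool" where
  "etri_iso \<C> = (\<lambda>(A, x, B, y, C, \<delta>) (A', x', B', y', C', \<delta>'). \<exists>a b c.
     is_iso \<C> A A' a \<and> is_iso \<C> B B' b \<and> is_iso \<C> C C' c \<and>
     b \<cdot>\<^bsub>\<C>\<^esub> x = x' \<cdot>\<^bsub>\<C>\<^esub> a \<and> y' \<cdot>\<^bsub>\<C>\<^esub> b = c \<cdot>\<^bsub>\<C>\<^esub> y \<and>
     push \<C> C a \<delta> = pull \<C> c A' \<delta>')"

text \<open>The empty coproduct is a split \<open>\<bbbE>\<close>-triangle, so binary coproducts suffice.\<close>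

locale proper_class =
  fixes \<C> :: "('o, 'm, 'e) extri" (structure) and \<xi> :: "('o, 'm, 'e) etri set"
  assumes proper_subset: "\<xi> \<subseteq> E_triangles \<C>"
    and iso_closed: "T \<in> \<xi> \<Longrightarrow> T' \<in> E_triangles \<C> \<Longrightarrow> etri_iso \<C> T T' \<Longrightarrow> T' \<in> \<xi>"
    and sum_closed: "closed_under_sums \<C> \<xi>"
    and split_in: "(A, x, B, y, C, \<one>\<^bsub>Ext \<C> C A\<^esub>) \<in> E_triangles \<C> \<Longrightarrow>
                     (A, x, B, y, C, \<one>\<^bsub>Ext \<C> C A\<^esub>) \<in> \<xi>"
    and base_change:
      "(A, x, B, y, C, \<delta>) \<in> \<xi> \<Longrightarrow> c \<in> mor \<C> C' C \<Longrightarrow>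
       (A, x', B', y', C', pull \<C> c A \<delta>) \<in> E_triangles \<C> \<Longrightarrow>
       (A, x', B', y', C', pull \<C> c A \<delta>) \<in> \<xi>"
    and cobase_change:
      "(A, x, B, y, C, \<delta>) \<in> \<xi> \<Longrightarrow> a \<in> mor \<C> A A' \<Longrightarrow>
       (A', x', B', y', C, push \<C> C a \<delta>) \<in> E_triangles \<C> \<Longrightarrow>
       (A', x', B', y', C, push \<C> C a \<delta>) \<in> \<xi>"
    and saturated:
      "(A\<^sub>1, x\<^sub>1, B\<^sub>1, y\<^sub>1, C, \<delta>\<^sub>1) \<in> E_triangles \<C> \<Longrightarrow>
       (A\<^sub>2, x\<^sub>2, B\<^sub>2, y\<^sub>2, C, \<delta>\<^sub>2) \<in> \<xi> \<Longrightarrow>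
       (A\<^sub>1, x, M, y, B\<^sub>2, pull \<C> y\<^sub>2 A\<^sub>1 \<delta>\<^sub>1) \<in> \<xi> \<Longrightarrow>
       (A\<^sub>1, x\<^sub>1, B\<^sub>1, y\<^sub>1, C, \<delta>\<^sub>1) \<in> \<xi>"

text \<open>\<open>short_exact_sequence\<close> lists its groups and maps from right to left.\<close>

definition xi_projectives :: "('o, 'm, 'e) extri \<Rightarrow> ('o, 'm, 'e) etri set \<Rightarrow> 'o set" where
  "xi_projectives \<C> \<xi> = {P. \<forall>A x B y C \<delta>. (A, x, B, y, C, \<delta>) \<in> \<xi> \<longrightarrow>
     short_exact_sequence (Hom \<C> P C) (Hom \<C> P B) (Hom \<C> P A)
       (\<lambda>h. y \<cdot>\<^bsub>\<C>\<^esub> h) (\<lambda>h. x \<cdot>\<^bsub>\<C>\<^esub> h)}"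

definition xi_injectives :: "('o, 'm, 'e) extri \<Rightarrow> ('o, 'm, 'e) etri set \<Rightarrow> 'o set" where
  "xi_injectives \<C> \<xi> = {I. \<forall>A x B y C \<delta>. (A, x, B, y, C, \<delta>) \<in> \<xi> \<longrightarrow>
     short_exact_sequence (Hom \<C> A I) (Hom \<C> B I) (Hom \<C> C I)
       (\<lambda>h. h \<cdot>\<^bsub>\<C>\<^esub> x) (\<lambda>h. h \<cdot>\<^bsub>\<C>\<^esub> y)}"

definition enough_xi_projectives ::
  "('o, 'm, 'e) extri \<Rightarrow> ('o, 'm, 'e) etri set \<Rightarrow> bool" where
  "enough_xi_projectives \<C> \<xi> \<longleftrightarrow>
     (\<forall>A. \<exists>K x P y \<delta>. (K, x, P, y, A, \<delta>) \<in> \<xi> \<and> P \<in> xi_projectives \<C> \<xi>)"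

definition enough_xi_injectives ::
  "('o, 'm, 'e) extri \<Rightarrow> ('o, 'm, 'e) etri set \<Rightarrow> bool" where
  "enough_xi_injectives \<C> \<xi> \<longleftrightarrow>
     (\<forall>A. \<exists>x I y K \<delta>. (A, x, I, y, K, \<delta>) \<in> \<xi> \<and> I \<in> xi_injectives \<C> \<xi>)"

section \<open>Exact complexes, resolutions and dimensions\<close>

text \<open>
  \<open>xi_exact_bounded \<C> \<xi> n X d M\<close>: the complex
  \<open>0 \<rightarrow> X n \<rightarrow> X (n - 1) \<rightarrow> \<dots> \<rightarrow> X 0 \<rightarrow> M \<rightarrow> 0\<close> is \<open>\<xi>\<close>-exact, where \<open>d 0 : X 0 \<rightarrow> M\<close> and
  \<open>d (i + 1) : X (i + 1) \<rightarrow> X i\<close>.  The leftmost term \<open>X n\<close> is the last syzygy \<open>K n\<close>, and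
  there are \<open>n\<close> resolution triangles.  Setting \<open>f n\<close> to the identity covers the end maps
  uniformly: \<open>d n = g (n - 1)\<close> if \<open>n > 0\<close>, and \<open>X 0 = M\<close>, \<open>d 0 = Id\<close> if \<open>n = 0\<close>.
\<close>

definition xi_exact_bounded ::
  "('o, 'm, 'e) extri \<Rightarrow> ('o, 'm, 'e) etri set \<Rightarrow>
     nat \<Rightarrow> (nat \<Rightarrow> 'o) \<Rightarrow> (nat \<Rightarrow> 'm) \<Rightarrow> 'o \<Rightarrow> bool" where
  "xi_exact_bounded \<C> \<xi> n X d M \<longleftrightarrow> (\<exists>K g f \<delta>.
     K 0 = M \<and> K n = X n \<and> f n = Id \<C> (X n) \<and>
     (\<forall>i<n. (K (Suc i), g i, X i, f i, K i, \<delta> i) \<in> \<xi>) \<and>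
     d 0 = f 0 \<and> (\<forall>i<n. d (Suc i) = g i \<cdot>\<^bsub>\<C>\<^esub> f (Suc i)))"

text \<open>The same for complexes \<open>\<dots> \<rightarrow> X 1 \<rightarrow> X 0 \<rightarrow> M \<rightarrow> 0\<close>.\<close>

definition xi_exact_left_unbounded ::
  "('o, 'm, 'e) extri \<Rightarrow> ('o, 'm, 'e) etri set \<Rightarrow>
     (nat \<Rightarrow> 'o) \<Rightarrow> (nat \<Rightarrow> 'm) \<Rightarrow> 'o \<Rightarrow> bool" where
  "xi_exact_left_unbounded \<C> \<xi> X d M \<longleftrightarrow> (\<exists>K g f \<delta>.
     K 0 = M \<and> (\<forall>i. (K (Suc i), g i, X i, f i, K i, \<delta> i) \<in> \<xi>) \<and>
     d 0 = f 0 \<and> (\<forall>i. d (Suc i) = g i \<cdot>\<^bsub>\<C>\<^esub> f (Suc i)))"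

text \<open>Full subcategories are given by their sets of objects.\<close>

definition additive_subcategory :: "('o, 'm, 'e) extri \<Rightarrow> 'o set \<Rightarrow> bool" where
  "additive_subcategory \<C> \<X> \<longleftrightarrow>
     (\<exists>Z \<in> \<X>. is_zero_object \<C> Z) \<and>
     (\<forall>A \<in> \<X>. \<forall>B \<in> \<X>. \<exists>s. is_biproduct \<C> A B s \<and> sumobj s \<in> \<X>)"

definition res :: "('o, 'm, 'e) extri \<Rightarrow> ('o, 'm, 'e) etri set \<Rightarrow> 'o set \<Rightarrow> 'o set" where
  "res \<C> \<xi> \<X> = {M. \<exists>X d. (\<forall>i. X i \<in> \<X>) \<and> xi_exact_left_unbounded \<C> \<xi> X d M}"

definition projectives_in ::
  "('o, 'm, 'e) extri \<Rightarrow> ('o, 'm, 'e) etri set \<Rightarrow> 'o set \<Rightarrow> 'o set" where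
  "projectives_in \<C> \<xi> \<X> = \<X> \<inter> xi_projectives \<C> \<xi>"

definition quasi_resolving ::
  "('o, 'm, 'e) extri \<Rightarrow> ('o, 'm, 'e) etri set \<Rightarrow> 'o set \<Rightarrow> bool" where
  "quasi_resolving \<C> \<xi> \<X> \<longleftrightarrow>
     additive_subcategory \<C> \<X> \<and>
     (\<forall>A x B y C \<delta>. (A, x, B, y, C, \<delta>) \<in> \<xi> \<longrightarrow>
        (A \<in> \<X> \<and> C \<in> \<X> \<longrightarrow> B \<in> \<X>) \<and> (B \<in> \<X> \<and> C \<in> \<X> \<longrightarrow> A \<in> \<X>)) \<and>
     \<X> \<subseteq> res \<C> \<xi> (projectives_in \<C> \<xi> \<X>)"

text \<open>The infimum of the empty set in \<^typ>\<open>enat\<close> is \<open>\<infinity>\<close>.\<close>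

definition res_dim ::
  "('o, 'm, 'e) extri \<Rightarrow> ('o, 'm, 'e) etri set \<Rightarrow> 'o set \<Rightarrow> 'o \<Rightarrow> enat" where
  "res_dim \<C> \<xi> \<Y> M =
     Inf {enat n | n. \<exists>Y d. (\<forall>i\<le>n. Y i \<in> \<Y>) \<and> xi_exact_bounded \<C> \<xi> n Y d M}"

definition xi_cogenerator ::
  "('o, 'm, 'e) extri \<Rightarrow> ('o, 'm, 'e) etri set \<Rightarrow> 'o set \<Rightarrow> 'o set \<Rightarrow> bool" where
  "xi_cogenerator \<C> \<xi> \<H> \<X> \<longleftrightarrow>
     additive_subcategory \<C> \<H> \<and> \<H> \<subseteq> \<X> \<and>
     (\<forall>X \<in> \<X>. \<exists>x H y X' \<delta>. (X, x, H, y, X', \<delta>) \<in> \<xi> \<and> H \<in> \<H> \<and> X' \<in> \<X>)"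

end

theory Submission
  imports Defs
begin

text \<open>
  The proof is the Auslander--Buchweitz approximation argument.  If \<open>M\<close> has an \<open>\<X>\<close>-resolution of
  length \<open>n\<close>, then \<open>M\<close> embeds into some \<open>W\<close> resolved by \<open>\<H>\<close> in \<open>n\<close> steps, with cokernel in \<open>\<X>\<close>, by
  induction on \<open>n\<close>.  Take the first step \<open>K \<rightarrow> X\<^sub>0 \<rightarrow> M\<close> of the resolution and, by induction, a triangle
  \<open>K \<rightarrow> W' \<rightarrow> X'\<close> with \<open>X' \<in> \<X>\<close> and \<open>W'\<close> resolved by \<open>\<H>\<close>.  With their pushout \<open>U\<close> there are triangles
  \<open>X\<^sub>0 \<rightarrow> U \<rightarrow> X'\<close>, so that \<open>U \<in> \<X>\<close>, and \<open>W' \<rightarrow> U \<rightarrow> M\<close>; the latter already gives a complex that ends in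
  \<open>U \<rightarrow> M\<close> and has all other terms in \<open>\<H>\<close>.  Embedding \<open>U\<close> into some \<open>H \<in> \<H>\<close> with cokernel in \<open>\<X>\<close>, the
  octahedral axiom for \<open>W' \<rightarrow> U \<rightarrow> H\<close> makes the cokernel of the composite the required \<open>W\<close>.  See
  \<open>replace_kernel\<close>, \<open>hull_exists\<close> and \<open>approximation_exists\<close>.

  For the complexes that start with \<open>m\<close> projectives, the first term of an \<open>\<X>\<close>-resolution is covered by
  a projective \<open>P\<close> in \<open>\<X>\<close>; the kernel of \<open>P \<rightarrow> M\<close> is an extension of the old syzygy by an object of \<open>\<X>\<close>,
  so it has an \<open>\<X>\<close>-resolution of the same length (\<open>resolved_extension\<close>), and \<open>m\<close> such steps are followed
  by an approximation as above.  Conversely, such a complex with \<open>m = 0\<close> is an \<open>\<X>\<close>-resolution because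
  \<open>\<H> \<subseteq> \<X>\<close>, and a triangle \<open>M \<rightarrow> W \<rightarrow> X\<close> bounds the dimension of \<open>M\<close> by that of \<open>W\<close> since \<open>\<X>\<close> is closed
  under cocones (\<open>resolved_cocone\<close>).

  All this needs two facts about a proper class \<open>\<xi>\<close>.  Pushouts and pullbacks of triangles of \<open>\<xi>\<close>
  exist and have all their rows and columns in \<open>\<xi>\<close> (\<open>pushout_triangles\<close>, \<open>pullback_triangles\<close>): they
  come from the octahedral axiom applied to a sum of two extensions, and the resulting triangles are
  transported along isomorphisms of their end terms (\<open>triangle_iso_transport\<close>).  Inflations and deflations of \<open>\<xi>\<close> compose
  (\<open>xi_octahedron\<close>, \<open>xi_octahedron_op\<close>): for deflations this is saturation, and for inflations it is
  the dual of saturation, which follows from saturation (\<open>cosaturated\<close>).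
\<close>

section \<open>Additive categories\<close>

context additive_category
begin

abbreviation zero_mor :: "'o \<Rightarrow> 'o \<Rightarrow> 'm" where
  "zero_mor A B \<equiv> \<one>\<^bsub>Hom \<C> A B\<^esub>"

lemma zero_mor_in_mor: "zero_mor A B \<in> mor \<C> A B"
  using comm_group.axioms(2)[OF Hom_comm_group[of A B]] by (simp add: group.is_monoid monoid.one_closed)

lemma Hom_group: "group (Hom \<C> A B)"
  using Hom_comm_group comm_group.axioms(2) by blast

lemma Comp_zero_right:
  assumes "g \<in> mor \<C> B C"
  shows "g \<cdot> zero_mor A B = zero_mor A C"
  using hom_one[OF Comp_hom_right[OF assms] Hom_group Hom_group] .

lemma Comp_zero_left:
  assumes "f \<in> mor \<C> A B"
  shows "zero_mor B C \<cdot> f = zero_mor A C"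
  using hom_one[OF Comp_hom_left[OF assms] Hom_group Hom_group] .

lemma Comp_add_right:
  assumes "g \<in> mor \<C> B C" "f \<in> mor \<C> A B" "f' \<in> mor \<C> A B"
  shows "g \<cdot> (f \<otimes>\<^bsub>Hom \<C> A B\<^esub> f') = (g \<cdot> f) \<otimes>\<^bsub>Hom \<C> A C\<^esub> (g \<cdot> f')"
  using hom_mult[OF Comp_hom_right[OF assms(1)] assms(2,3)] .

lemma Comp_add_left:
  assumes "f \<in> mor \<C> A B" "g \<in> mor \<C> B C" "g' \<in> mor \<C> B C"
  shows "(g \<otimes>\<^bsub>Hom \<C> B C\<^esub> g') \<cdot> f = (g \<cdot> f) \<otimes>\<^bsub>Hom \<C> A C\<^esub> (g' \<cdot> f)"
  using hom_mult[OF Comp_hom_left[OF assms(1)] assms(2,3)] .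

lemma mor_to_zero_object: "is_zero_object \<C> Z \<Longrightarrow> f \<in> mor \<C> A Z \<Longrightarrow> f = zero_mor A Z"
  by (metis is_zero_object_def singletonD)

lemma is_iso_Id: "is_iso \<C> A A (Id \<C> A)"
  unfolding is_iso_def using Id_in_mor Comp_Id_left by blast

lemma is_isoE:
  assumes "is_iso \<C> A B f"
  obtains g where "f \<in> mor \<C> A B" "g \<in> mor \<C> B A" "g \<cdot> f = Id \<C> A" "f \<cdot> g = Id \<C> B"
    "is_iso \<C> B A g"
  using assms unfolding is_iso_def by blast

lemma is_iso_Comp:
  assumes "is_iso \<C> A B f" "is_iso \<C> B C g"
  shows "is_iso \<C> A C (g \<cdot> f)"
proof -
  obtain f' where f: "f \<in> mor \<C> A B" "f' \<in> mor \<C> B A" "f' \<cdot> f = Id \<C> A" "f \<cdot> f' = Id \<C> B"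
    using assms(1) by (rule is_isoE)
  obtain g' where g: "g \<in> mor \<C> B C" "g' \<in> mor \<C> C B" "g' \<cdot> g = Id \<C> B" "g \<cdot> g' = Id \<C> C"
    using assms(2) by (rule is_isoE)
  have "(f' \<cdot> g') \<cdot> (g \<cdot> f) = Id \<C> A"
    using Comp_assoc[OF Comp_in_mor[OF f(1) g(1)] g(2) f(2)] Comp_assoc[OF f(1) g(1,2)]
      Comp_Id_left[OF f(1)] f(3) g(3) by simp
  moreover have "(g \<cdot> f) \<cdot> (f' \<cdot> g') = Id \<C> C"
    using Comp_assoc[OF Comp_in_mor[OF g(2) f(2)] f(1) g(1)] Comp_assoc[OF g(2) f(2,1)]
      Comp_Id_left[OF g(2)] f(4) g(4) by simp
  ultimately show ?thesis
    unfolding is_iso_def using f g Comp_in_mor by blast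
qed

lemma is_iso_if_both_composites_iso:
  assumes f: "f \<in> mor \<C> A B" and g: "g \<in> mor \<C> B A"
    and gf: "is_iso \<C> A A (g \<cdot> f)" and fg: "is_iso \<C> B B (f \<cdot> g)"
  shows "is_iso \<C> A B f"
proof -
  obtain u where u: "u \<in> mor \<C> A A" "u \<cdot> (g \<cdot> f) = Id \<C> A"
    using gf by (rule is_isoE)
  obtain v where v: "v \<in> mor \<C> B B" "(f \<cdot> g) \<cdot> v = Id \<C> B"
    using fg by (rule is_isoE)
  have l: "(u \<cdot> g) \<cdot> f = Id \<C> A"
    using u f g by (simp add: Comp_assoc[OF f g u(1)])
  have r: "f \<cdot> (g \<cdot> v) = Id \<C> B"
    using v f g by (simp add: Comp_assoc[OF v(1) g f])
  have ug: "u \<cdot> g \<in> mor \<C> B A" and gv: "g \<cdot> v \<in> mor \<C> B A"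
    using u v f g Comp_in_mor by blast+
  have "u \<cdot> g = (u \<cdot> g) \<cdot> (f \<cdot> (g \<cdot> v))"
    using r ug Comp_Id_right by simp
  also have "\<dots> = ((u \<cdot> g) \<cdot> f) \<cdot> (g \<cdot> v)"
    using Comp_assoc[OF gv f ug] by simp
  also have "\<dots> = g \<cdot> v"
    using l gv Comp_Id_left by simp
  finally show ?thesis
    unfolding is_iso_def using f gv l r by metis
qed

text \<open>The inverse is \<open>1 - n\<close>, as \<open>(1 + n)(1 - n) = 1 - n\<^sup>2\<close>.\<close>

lemma is_iso_unipotent:
  assumes n: "n \<in> mor \<C> B B" and nn: "n \<cdot> n = zero_mor B B"
  shows "is_iso \<C> B B (Id \<C> B \<otimes>\<^bsub>Hom \<C> B B\<^esub> n)"
proof -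
  interpret G: comm_group "Hom \<C> B B" by (rule Hom_comm_group)
  let ?h = "Id \<C> B \<otimes>\<^bsub>Hom \<C> B B\<^esub> n"
  let ?m = "inv\<^bsub>Hom \<C> B B\<^esub> n"
  let ?g = "Id \<C> B \<otimes>\<^bsub>Hom \<C> B B\<^esub> ?m"
  note I = Id_in_mor[of B]
  have m: "?m \<in> mor \<C> B B" using n by simp
  have h: "?h \<in> mor \<C> B B" and g: "?g \<in> mor \<C> B B" using n I by simp_all
  have hn: "?h \<cdot> n = n"
    using Comp_add_left[OF n I n] nn n Comp_Id_left[OF n] by simp
  have nh: "n \<cdot> ?h = n"
    using Comp_add_right[OF n I n] nn n Comp_Id_right[OF n] by simp
  have "(?h \<cdot> ?m) \<otimes>\<^bsub>Hom \<C> B B\<^esub> n = zero_mor B B"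
    using Comp_add_right[OF h m n] hn n m Comp_zero_right[OF h] by simp
  then have hm: "?h \<cdot> ?m = ?m"
    using G.inv_equality n Comp_in_mor[OF m h] by metis
  have "(?m \<cdot> ?h) \<otimes>\<^bsub>Hom \<C> B B\<^esub> n = zero_mor B B"
    using Comp_add_left[OF h m n] nh n m Comp_zero_left[OF h] by simp
  then have mh: "?m \<cdot> ?h = ?m"
    using G.inv_equality n Comp_in_mor[OF h m] by metis
  have c: "?h \<otimes>\<^bsub>Hom \<C> B B\<^esub> ?m = Id \<C> B"
    using n m I by (simp add: G.m_assoc)
  have "?h \<cdot> ?g = Id \<C> B"
    using Comp_add_right[OF h I m] hm Comp_Id_right[OF h] c by simp
  moreover have "?g \<cdot> ?h = Id \<C> B"
    using Comp_add_left[OF h I m] mh Comp_Id_left[OF h] c by simp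
  ultimately show ?thesis unfolding is_iso_def using h g by blast
qed

lemma is_biproduct_swap:
  assumes "is_biproduct \<C> A B s"
  shows "is_biproduct \<C> B A \<lparr>sumobj = sumobj s, in1 = in2 s, in2 = in1 s, pr1 = pr2 s, pr2 = pr1 s\<rparr>"
proof -
  interpret G: comm_group "Hom \<C> (sumobj s) (sumobj s)" by (rule Hom_comm_group)
  show ?thesis
    using assms G.m_comm[of "in2 s \<cdot> pr2 s" "in1 s \<cdot> pr1 s"]
      Comp_in_mor[of "pr1 s" "sumobj s" A "in1 s"] Comp_in_mor[of "pr2 s" "sumobj s" B "in2 s"]
    unfolding is_biproduct_def by simp
qed

end

section \<open>E-triangles\<close>

context extriangulated_category
begin

abbreviation zero_ext :: "'o \<Rightarrow> 'o \<Rightarrow> 'e" where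
  "zero_ext C A \<equiv> \<one>\<^bsub>Ext \<C> C A\<^esub>"

lemma Ext_group: "group (Ext \<C> C A)"
  using Ext_comm_group comm_group.axioms(2) by blast

lemma zero_ext_in_ext: "zero_ext C A \<in> ext \<C> C A"
  using Ext_group by (simp add: group.is_monoid monoid.one_closed)

lemma push_in_ext: "a \<in> mor \<C> A A' \<Longrightarrow> \<delta> \<in> ext \<C> C A \<Longrightarrow> push \<C> C a \<delta> \<in> ext \<C> C A'"
  using push_hom hom_in_carrier by fast

lemma pull_in_ext: "c \<in> mor \<C> C' C \<Longrightarrow> \<delta> \<in> ext \<C> C A \<Longrightarrow> pull \<C> c A \<delta> \<in> ext \<C> C' A"
  using pull_hom hom_in_carrier by fast

lemma push_zero_ext: "a \<in> mor \<C> A A' \<Longrightarrow> push \<C> C a (zero_ext C A) = zero_ext C A'"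
  using hom_one[OF push_hom Ext_group Ext_group] .

lemma push_zero_mor:
  assumes "\<delta> \<in> ext \<C> C A"
  shows "push \<C> C (zero_mor A A') \<delta> = zero_ext C A'"
proof -
  interpret H: group "Hom \<C> A A'" by (rule Hom_group)
  interpret G: group "Ext \<C> C A'" by (rule Ext_group)
  have "push \<C> C (zero_mor A A') \<delta> \<in> ext \<C> C A'"
    using push_in_ext zero_mor_in_mor assms by blast
  then show ?thesis
    using push_add[OF zero_mor_in_mor zero_mor_in_mor assms, of A'] by simp
qed

lemma pull_zero_mor:
  assumes "\<delta> \<in> ext \<C> C A"
  shows "pull \<C> (zero_mor C' C) A \<delta> = zero_ext C' A"
proof -
  interpret H: group "Hom \<C> C' C" by (rule Hom_group)
  interpret G: group "Ext \<C> C' A" by (rule Ext_group)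
  have "pull \<C> (zero_mor C' C) A \<delta> \<in> ext \<C> C' A"
    using pull_in_ext zero_mor_in_mor assms by blast
  then show ?thesis
    using pull_add[OF zero_mor_in_mor zero_mor_in_mor assms, of C'] by simp
qed

lemma E_triangleD:
  assumes "(A, x, B, y, C, \<delta>) \<in> E_triangles \<C>"
  shows "x \<in> mor \<C> A B" "y \<in> mor \<C> B C" "\<delta> \<in> ext \<C> C A" "(x, y) \<in> realiz \<C> C A \<delta>"
  using assms by (auto simp: E_triangles_def)

subsection \<open>Realizations\<close>

lemma seq_equiv_equiv: "equiv (seqs \<C> A C) (seq_equiv \<C> A C)"
proof (rule equivI)
  show "seq_equiv \<C> A C \<subseteq> seqs \<C> A C \<times> seqs \<C> A C"
    by (auto simp: seq_equiv_def seqs_def)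
  show "refl_on (seqs \<C> A C) (seq_equiv \<C> A C)"
    by (rule refl_onI)
      (auto simp: seq_equiv_def seqs_def intro: is_iso_Id Comp_Id_left Comp_Id_right)
  show "sym (seq_equiv \<C> A C)"
  proof (rule symI, clarify)
    fix x y x' y' assume "((x, y), (x', y')) \<in> seq_equiv \<C> A C"
    then obtain B B' b where m: "x \<in> mor \<C> A B" "y \<in> mor \<C> B C" "x' \<in> mor \<C> A B'" "y' \<in> mor \<C> B' C"
      and b: "is_iso \<C> B B' b" "b \<cdot> x = x'" "y' \<cdot> b = y"
      unfolding seq_equiv_def by blast
    obtain g where g: "b \<in> mor \<C> B B'" "g \<in> mor \<C> B' B" "g \<cdot> b = Id \<C> B" "b \<cdot> g = Id \<C> B'"
      "is_iso \<C> B' B g"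
      using b(1) by (rule is_isoE)
    have "g \<cdot> x' = x" "y \<cdot> g = y'"
      using g b m Comp_assoc Comp_Id_left Comp_Id_right by metis+
    then show "((x', y'), (x, y)) \<in> seq_equiv \<C> A C"
      unfolding seq_equiv_def using m g by blast
  qed
  show "trans (seq_equiv \<C> A C)"
  proof (rule transI, clarify)
    fix x y x' y' x'' y''
    assume 1: "((x, y), (x', y')) \<in> seq_equiv \<C> A C" and 2: "((x', y'), (x'', y'')) \<in> seq_equiv \<C> A C"
    obtain B B' b where m: "x \<in> mor \<C> A B" "y \<in> mor \<C> B C" "x' \<in> mor \<C> A B'"
      and b: "is_iso \<C> B B' b" "b \<cdot> x = x'" "y' \<cdot> b = y"
      using 1 unfolding seq_equiv_def by blast
    obtain D B'' b' where m': "x' \<in> mor \<C> A D" "x'' \<in> mor \<C> A B''" "y'' \<in> mor \<C> B'' C"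
      and b': "is_iso \<C> D B'' b'" "b' \<cdot> x' = x''" "y'' \<cdot> b' = y'"
      using 2 unfolding seq_equiv_def by blast
    have D: "D = B'" using Hom_disjoint m m' by blast
    have bm: "b \<in> mor \<C> B B'" "b' \<in> mor \<C> B' B''" using b b' D unfolding is_iso_def by auto
    have "(b' \<cdot> b) \<cdot> x = x''" using b b' Comp_assoc[OF m(1) bm] by simp
    moreover have "y'' \<cdot> (b' \<cdot> b) = y" using b b' Comp_assoc[OF bm m'(3)] by simp
    moreover have "is_iso \<C> B B'' (b' \<cdot> b)" using is_iso_Comp b b' D by blast
    ultimately show "((x, y), (x'', y'')) \<in> seq_equiv \<C> A C"
      unfolding seq_equiv_def using m m' by blast
  qed
qed

lemma realization_exists:
  assumes "\<delta> \<in> ext \<C> C A"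
  obtains x B y where "(A, x, B, y, C, \<delta>) \<in> E_triangles \<C>"
proof -
  have q: "realiz \<C> C A \<delta> \<in> seqs \<C> A C // seq_equiv \<C> A C" using assms by (rule realiz_class)
  have "realiz \<C> C A \<delta> \<noteq> {}" using in_quotient_imp_non_empty[OF seq_equiv_equiv q] .
  moreover have "realiz \<C> C A \<delta> \<subseteq> seqs \<C> A C" using in_quotient_imp_subset[OF seq_equiv_equiv q] .
  ultimately obtain x y B where "(x, y) \<in> realiz \<C> C A \<delta>" "x \<in> mor \<C> A B" "y \<in> mor \<C> B C"
    unfolding seqs_def by blast
  then show ?thesis using that assms unfolding E_triangles_def by blast
qed

lemma realization_unique:
  assumes "(A, x, B, y, C, \<delta>) \<in> E_triangles \<C>" "(A, x', B', y', C, \<delta>) \<in> E_triangles \<C>"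
  obtains b where "is_iso \<C> B B' b" "b \<cdot> x = x'" "y' \<cdot> b = y"
proof -
  note D = E_triangleD[OF assms(1)] and D' = E_triangleD[OF assms(2)]
  have "((x, y), (x', y')) \<in> seq_equiv \<C> A C"
    using in_quotient_imp_in_rel[OF seq_equiv_equiv realiz_class[OF D(3)]] D(4) D'(4) by blast
  then obtain E E' b where "x \<in> mor \<C> A E" "x' \<in> mor \<C> A E'" "is_iso \<C> E E' b" "b \<cdot> x = x'" "y' \<cdot> b = y"
    unfolding seq_equiv_def by blast
  then show ?thesis using that Hom_disjoint D D' by metis
qed

lemma realization_iso:
  assumes t: "(A, x', B', y', C, \<delta>) \<in> E_triangles \<C>"
    and m: "x \<in> mor \<C> A B" "y \<in> mor \<C> B C"
    and b: "is_iso \<C> B B' b" "b \<cdot> x = x'" "y' \<cdot> b = y"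
  shows "(A, x, B, y, C, \<delta>) \<in> E_triangles \<C>"
proof -
  note D = E_triangleD[OF t]
  have "((x, y), (x', y')) \<in> seq_equiv \<C> A C"
    unfolding seq_equiv_def using m b D by blast
  then have "((x', y'), (x, y)) \<in> seq_equiv \<C> A C"
    using seq_equiv_equiv unfolding equiv_def sym_def by blast
  then have "(x, y) \<in> realiz \<C> C A \<delta>"
    using in_quotient_imp_closed[OF seq_equiv_equiv realiz_class[OF D(3)] D(4)] by blast
  then show ?thesis using m D unfolding E_triangles_def by blast
qed

subsection \<open>Split triangles\<close>

lemma biproduct_triangle:
  assumes "is_biproduct \<C> A C s"
  shows "(A, in1 s, sumobj s, pr2 s, C, zero_ext C A) \<in> E_triangles \<C>"
  using assms realiz_zero[OF assms] zero_ext_in_ext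
  unfolding E_triangles_def is_biproduct_def by simp

lemma iso_triangle_from_zero:
  assumes Z: "is_zero_object \<C> Z" and c: "is_iso \<C> B C c"
  shows "(Z, zero_mor Z B, B, c, C, zero_ext C Z) \<in> E_triangles \<C>"
proof -
  interpret G: group "Hom \<C> B B" by (rule Hom_group)
  obtain c' where c: "c \<in> mor \<C> B C" "c' \<in> mor \<C> C B" "c' \<cdot> c = Id \<C> B" "c \<cdot> c' = Id \<C> C"
    using c by (rule is_isoE)
  have "zero_mor B Z \<cdot> zero_mor Z B = Id \<C> Z"
    using Comp_zero_left zero_mor_in_mor mor_to_zero_object[OF Z Id_in_mor] by metis
  moreover have "zero_mor Z B \<cdot> zero_mor B Z = zero_mor B B"
    using Comp_zero_left zero_mor_in_mor by metis
  ultimately have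
    "is_biproduct \<C> Z C \<lparr>sumobj = B, in1 = zero_mor Z B, in2 = c', pr1 = zero_mor B Z, pr2 = c\<rparr>"
    unfolding is_biproduct_def using c zero_mor_in_mor Id_in_mor[of B] Comp_zero_right[OF c(1)] Comp_zero_left[OF c(2)]
    by simp
  from biproduct_triangle[OF this] show ?thesis by simp
qed

subsection \<open>Exactness\<close>

text \<open>As \<open>u x = 0\<close>, the maps \<open>A \<rightarrow> 0\<close> and \<open>u\<close> form a square into the split triangle \<open>0 \<rightarrow> D \<rightarrow> D\<close>, and the
  third map of a morphism of triangles is the factorization.\<close>

lemma weak_cokernel:
  assumes t: "(A, x, B, y, C, \<delta>) \<in> E_triangles \<C>"
    and u: "u \<in> mor \<C> B D" "u \<cdot> x = zero_mor A D"
  obtains t where "t \<in> mor \<C> C D" "u = t \<cdot> y"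
proof -
  obtain Z where Z: "is_zero_object \<C> Z" using zero_object_exists by blast
  have "u \<cdot> x = zero_mor Z D \<cdot> zero_mor A Z"
    using u Comp_zero_left zero_mor_in_mor by metis
  from ET3[OF t iso_triangle_from_zero[OF Z is_iso_Id] zero_mor_in_mor u(1) this]
  obtain c where "c \<in> mor \<C> C D" "Id \<C> D \<cdot> u = c \<cdot> y" by blast
  then show ?thesis using that u Comp_Id_left by metis
qed

text \<open>The maps \<open>1\<^sub>B\<close> and \<open>y\<close> form a square from the split triangle \<open>0 \<rightarrow> B \<rightarrow> B\<close>, whose extension is \<open>0\<close>.\<close>

lemma pull_deflation_zero:
  assumes t: "(A, x, B, y, C, \<delta>) \<in> E_triangles \<C>"
  shows "pull \<C> y A \<delta> = zero_ext B A"
proof -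
  obtain Z where Z: "is_zero_object \<C> Z" using zero_object_exists by blast
  note D = E_triangleD[OF t]
  have "y \<cdot> Id \<C> B = y \<cdot> Id \<C> B" ..
  from ET3_op[OF iso_triangle_from_zero[OF Z is_iso_Id] t Id_in_mor D(2) this]
  obtain a where "a \<in> mor \<C> Z A" "push \<C> B a (zero_ext B Z) = pull \<C> y A \<delta>" by blast
  then show ?thesis using push_zero_ext by metis
qed

text \<open>This is exactness of \<open>\<C>(U,C) \<rightarrow> \<bbbE>(U,A) \<rightarrow> \<bbbE>(U,B)\<close>: if \<open>x\<^sub>*\<epsilon>\<close> splits, then \<open>x\<close> extends along
  the inflation of a realization of \<open>\<epsilon>\<close>, and the map of third terms that this
  induces is the required one.\<close>

lemma killed_by_inflation_is_pullback:
  assumes t: "(A, x, B, y, C, \<delta>) \<in> E_triangles \<C>"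
    and e: "\<epsilon> \<in> ext \<C> U A" "push \<C> U x \<epsilon> = zero_ext U B"
  obtains c where "c \<in> mor \<C> U C" "\<epsilon> = pull \<C> c A \<delta>"
proof -
  note D = E_triangleD[OF t]
  obtain v V w where T: "(A, v, V, w, U, \<epsilon>) \<in> E_triangles \<C>" using e(1) by (rule realization_exists)
  note DT = E_triangleD[OF T]
  obtain s where s: "is_biproduct \<C> B U s" using biproduct_exists by blast
  have sm: "in1 s \<in> mor \<C> B (sumobj s)" "pr1 s \<in> mor \<C> (sumobj s) B" "pr1 s \<cdot> in1 s = Id \<C> B"
    using s unfolding is_biproduct_def by auto
  have "push \<C> U x \<epsilon> = pull \<C> (Id \<C> U) B (zero_ext U B)"
    using e pull_Id zero_ext_in_ext by metis
  from realiz_mor[OF T biproduct_triangle[OF s] D(1) Id_in_mor this]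
  obtain b where b: "b \<in> mor \<C> V (sumobj s)" "b \<cdot> v = in1 s \<cdot> x" by blast
  have pb: "pr1 s \<cdot> b \<in> mor \<C> V B" using b sm Comp_in_mor by blast
  have "(pr1 s \<cdot> b) \<cdot> v = (pr1 s \<cdot> in1 s) \<cdot> x"
    using Comp_assoc[OF DT(1) b(1) sm(2)] Comp_assoc[OF D(1) sm(1,2)] b(2) by simp
  also have "\<dots> = x \<cdot> Id \<C> A" using sm D Comp_Id_left Comp_Id_right by metis
  finally obtain c where "c \<in> mor \<C> U C" "push \<C> U (Id \<C> A) \<epsilon> = pull \<C> c A \<delta>"
    using ET3[OF T t Id_in_mor pb] by blast
  then show ?thesis using that push_Id e by metis
qed

subsection \<open>Transport along isomorphisms\<close>

text \<open>The difference \<open>h - 1\<close> kills \<open>x\<close>, hence factors through \<open>y\<close>; as \<open>y\<close> kills it, it squares to \<open>0\<close>.\<close>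

lemma middle_endo_iso:
  assumes t: "(A, x, B, y, C, \<delta>) \<in> E_triangles \<C>"
    and h: "h \<in> mor \<C> B B" "h \<cdot> x = x" "y \<cdot> h = y"
  shows "is_iso \<C> B B h"
proof -
  interpret G: comm_group "Hom \<C> B B" by (rule Hom_comm_group)
  interpret H: group "Hom \<C> A B" by (rule Hom_group)
  interpret K: group "Hom \<C> B C" by (rule Hom_group)
  note D = E_triangleD[OF t]
  note I = Id_in_mor[of B]
  define n where "n = inv\<^bsub>Hom \<C> B B\<^esub> (Id \<C> B) \<otimes>\<^bsub>Hom \<C> B B\<^esub> h"
  have n: "n \<in> mor \<C> B B" unfolding n_def using h I by simp
  have hn: "h = Id \<C> B \<otimes>\<^bsub>Hom \<C> B B\<^esub> n"
    unfolding n_def using h I by (simp add: G.m_assoc[symmetric])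
  have "x \<otimes>\<^bsub>Hom \<C> A B\<^esub> (n \<cdot> x) = x"
    using Comp_add_left[OF D(1) I n] hn h(2) Comp_Id_left[OF D(1)] by simp
  then have nx: "n \<cdot> x = zero_mor A B"
    using D(1) Comp_in_mor[OF D(1) n] by simp
  have "y \<otimes>\<^bsub>Hom \<C> B C\<^esub> (y \<cdot> n) = y"
    using Comp_add_right[OF D(2) I n] hn h(3) Comp_Id_right[OF D(2)] by simp
  then have yn: "y \<cdot> n = zero_mor B C"
    using D(2) Comp_in_mor[OF n D(2)] by simp
  obtain k where k: "k \<in> mor \<C> C B" "n = k \<cdot> y" using weak_cokernel[OF t n nx] .
  have "n \<cdot> n = k \<cdot> (y \<cdot> n)" using Comp_assoc[OF n D(2) k(1)] k(2) by simp
  also have "\<dots> = zero_mor B B" using yn Comp_zero_right[OF k(1)] by simp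
  finally show ?thesis using is_iso_unipotent[OF n] hn by simp
qed

text \<open>The isomorphisms of the end terms lift to morphisms between the given triangle and a
  realization of the transported extension, in both directions; the composites are isomorphisms of
  the middle terms by the preceding lemma.\<close>

lemma triangle_iso_transport:
  assumes t: "(A, x, B, y, C, \<delta>) \<in> E_triangles \<C>"
    and a: "a \<in> mor \<C> A A'" "a' \<in> mor \<C> A' A" "a' \<cdot> a = Id \<C> A" "a \<cdot> a' = Id \<C> A'"
    and c: "c \<in> mor \<C> C C'" "c' \<in> mor \<C> C' C" "c' \<cdot> c = Id \<C> C" "c \<cdot> c' = Id \<C> C'"
  shows "(A', x \<cdot> a', B, c \<cdot> y, C', push \<C> C' a (pull \<C> c' A \<delta>)) \<in> E_triangles \<C>"
proof -
  note D = E_triangleD[OF t]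
  let ?d = "push \<C> C' a (pull \<C> c' A \<delta>)"
  have pd: "pull \<C> c' A \<delta> \<in> ext \<C> C' A" using pull_in_ext[OF c(2) D(3)] .
  have d: "?d \<in> ext \<C> C' A'" using push_in_ext[OF a(1) pd] .
  obtain x' B' y' where T: "(A', x', B', y', C', ?d) \<in> E_triangles \<C>"
    using d by (rule realization_exists)
  note DT = E_triangleD[OF T]
  have "pull \<C> c A' ?d = push \<C> C a (pull \<C> c A (pull \<C> c' A \<delta>))"
    using push_pull[OF a(1) c(1) pd] by simp
  also have "pull \<C> c A (pull \<C> c' A \<delta>) = \<delta>"
    using pull_Comp[OF c(1,2) D(3)] c(3) pull_Id[OF D(3)] by simp
  finally have "push \<C> C a \<delta> = pull \<C> c A' ?d" by simp
  from realiz_mor[OF t T a(1) c(1) this] obtain b where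
    b: "b \<in> mor \<C> B B'" "b \<cdot> x = x' \<cdot> a" "y' \<cdot> b = c \<cdot> y" by blast
  have "push \<C> C' a' ?d = pull \<C> c' A \<delta>"
    using push_Comp[OF a(1,2) pd] a(3) push_Id[OF pd] by simp
  from realiz_mor[OF T t a(2) c(2) this] obtain b' where
    b': "b' \<in> mor \<C> B' B" "b' \<cdot> x' = x \<cdot> a'" "y \<cdot> b' = c' \<cdot> y'" by blast
  have "(b' \<cdot> b) \<cdot> x = x \<cdot> (a' \<cdot> a)"
    using Comp_assoc[OF D(1) b(1) b'(1)] Comp_assoc[OF a(1) DT(1) b'(1)]
      Comp_assoc[OF a(1,2) D(1)] b(2) b'(2) by simp
  moreover have "y \<cdot> (b' \<cdot> b) = (c' \<cdot> c) \<cdot> y"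
    using Comp_assoc[OF b(1) b'(1) D(2)] Comp_assoc[OF b(1) DT(2) c(2)]
      Comp_assoc[OF D(2) c(1,2)] b(3) b'(3) by simp
  ultimately have i1: "is_iso \<C> B B (b' \<cdot> b)"
    using middle_endo_iso[OF t Comp_in_mor[OF b(1) b'(1)]] a c D Comp_Id_left Comp_Id_right by metis
  have "(b \<cdot> b') \<cdot> x' = x' \<cdot> (a \<cdot> a')"
    using Comp_assoc[OF DT(1) b'(1) b(1)] Comp_assoc[OF a(2) D(1) b(1)]
      Comp_assoc[OF a(2,1) DT(1)] b(2) b'(2) by simp
  moreover have "y' \<cdot> (b \<cdot> b') = (c \<cdot> c') \<cdot> y'"
    using Comp_assoc[OF b'(1) b(1) DT(2)] Comp_assoc[OF b'(1) D(2) c(1)]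
      Comp_assoc[OF DT(2) c(2,1)] b(3) b'(3) by simp
  ultimately have i2: "is_iso \<C> B' B' (b \<cdot> b')"
    using middle_endo_iso[OF T Comp_in_mor[OF b'(1) b(1)]] a c DT Comp_Id_left Comp_Id_right by metis
  have i: "is_iso \<C> B B' b" using is_iso_if_both_composites_iso[OF b(1) b'(1) i1 i2] .
  have "b \<cdot> (x \<cdot> a') = x' \<cdot> (a \<cdot> a')"
    using Comp_assoc[OF a(2) D(1) b(1)] Comp_assoc[OF a(2,1) DT(1)] b(2) by simp
  then have "b \<cdot> (x \<cdot> a') = x'" using a DT Comp_Id_right by metis
  then show ?thesis
    using realization_iso[OF T Comp_in_mor[OF a(2) D(1)] Comp_in_mor[OF D(2) c(1)] i] b(3) by blast
qed

subsection \<open>Pushouts and pullbacks of triangles\<close>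

text \<open>One half of the pushout of two triangles out of \<open>A\<close>.  The pushout is the middle term of
  \<open>pr\<^sub>1\<^sup>*\<delta>\<^sub>1 + pr\<^sub>2\<^sup>*\<delta>\<^sub>2\<close>; composing its deflation with \<open>pr\<^sub>2\<close>, the octahedral axiom produces a triangle
  that realizes \<open>\<delta>\<^sub>1\<close>, so that its middle term can be exchanged for \<open>B\<^sub>1\<close>.\<close>

lemma pushout_half:
  assumes t1: "(A, x\<^sub>1, B\<^sub>1, y\<^sub>1, C\<^sub>1, \<delta>\<^sub>1) \<in> E_triangles \<C>"
    and d2: "\<delta>\<^sub>2 \<in> ext \<C> C\<^sub>2 A"
    and s: "is_biproduct \<C> C\<^sub>1 C\<^sub>2 s"
    and T: "(A, v, V, q, sumobj s, pull \<C> (pr1 s) A \<delta>\<^sub>1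
              \<otimes>\<^bsub>Ext \<C> (sumobj s) A\<^esub> pull \<C> (pr2 s) A \<delta>\<^sub>2) \<in> E_triangles \<C>"
  obtains u w where "(B\<^sub>1, u, V, w, C\<^sub>2, push \<C> C\<^sub>2 x\<^sub>1 \<delta>\<^sub>2) \<in> E_triangles \<C>"
proof -
  note D1 = E_triangleD[OF t1]
  have sm: "in1 s \<in> mor \<C> C\<^sub>1 (sumobj s)" "in2 s \<in> mor \<C> C\<^sub>2 (sumobj s)"
    "pr1 s \<in> mor \<C> (sumobj s) C\<^sub>1" "pr2 s \<in> mor \<C> (sumobj s) C\<^sub>2"
    "pr1 s \<cdot> in1 s = Id \<C> C\<^sub>1" "pr2 s \<cdot> in2 s = Id \<C> C\<^sub>2"
    "pr2 s \<cdot> in1 s = zero_mor C\<^sub>1 C\<^sub>2" "pr1 s \<cdot> in2 s = zero_mor C\<^sub>2 C\<^sub>1"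
    using s unfolding is_biproduct_def by auto
  let ?p1 = "pull \<C> (pr1 s) A \<delta>\<^sub>1" and ?p2 = "pull \<C> (pr2 s) A \<delta>\<^sub>2"
  let ?d = "?p1 \<otimes>\<^bsub>Ext \<C> (sumobj s) A\<^esub> ?p2"
  have p: "?p1 \<in> ext \<C> (sumobj s) A" "?p2 \<in> ext \<C> (sumobj s) A"
    using pull_in_ext sm D1 d2 by blast+
  interpret G1: group "Ext \<C> C\<^sub>1 A" by (rule Ext_group)
  interpret G2: group "Ext \<C> C\<^sub>2 A" by (rule Ext_group)
  have "pull \<C> (in1 s) A ?d = pull \<C> (in1 s) A ?p1 \<otimes>\<^bsub>Ext \<C> C\<^sub>1 A\<^esub> pull \<C> (in1 s) A ?p2"
    using hom_mult[OF pull_hom[OF sm(1)] p] .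
  also have "pull \<C> (in1 s) A ?p1 = \<delta>\<^sub>1"
    using pull_Comp[OF sm(1,3) D1(3)] unfolding sm(5) pull_Id[OF D1(3)] by (rule sym)
  also have "pull \<C> (in1 s) A ?p2 = zero_ext C\<^sub>1 A"
    using pull_Comp[OF sm(1,4) d2] unfolding sm(7) pull_zero_mor[OF d2] by (rule sym)
  also have "\<delta>\<^sub>1 \<otimes>\<^bsub>Ext \<C> C\<^sub>1 A\<^esub> zero_ext C\<^sub>1 A = \<delta>\<^sub>1" using D1(3) by simp
  finally have i1: "pull \<C> (in1 s) A ?d = \<delta>\<^sub>1" .
  have "pull \<C> (in2 s) A ?d = pull \<C> (in2 s) A ?p1 \<otimes>\<^bsub>Ext \<C> C\<^sub>2 A\<^esub> pull \<C> (in2 s) A ?p2"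
    using hom_mult[OF pull_hom[OF sm(2)] p] .
  also have "pull \<C> (in2 s) A ?p1 = zero_ext C\<^sub>2 A"
    using pull_Comp[OF sm(2,3) D1(3)] unfolding sm(8) pull_zero_mor[OF D1(3)] by (rule sym)
  also have "pull \<C> (in2 s) A ?p2 = \<delta>\<^sub>2"
    using pull_Comp[OF sm(2,4) d2] unfolding sm(6) pull_Id[OF d2] by (rule sym)
  also have "zero_ext C\<^sub>2 A \<otimes>\<^bsub>Ext \<C> C\<^sub>2 A\<^esub> \<delta>\<^sub>2 = \<delta>\<^sub>2" using d2 by simp
  finally have i2: "pull \<C> (in2 s) A ?d = \<delta>\<^sub>2" .
  from ET4_op[OF biproduct_triangle[OF s] T] obtain E h' \<delta>'' k e where
    E1: "(E, h', V, pr2 s \<cdot> q, C\<^sub>2, \<delta>'') \<in> E_triangles \<C>" and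
    E2: "(A, e, E, k, C\<^sub>1, pull \<C> (in1 s) A ?d) \<in> E_triangles \<C>" and
    eq: "pull \<C> (pr2 s) E \<delta>'' = push \<C> (sumobj s) e ?d" by blast
  note DE1 = E_triangleD[OF E1] and DE2 = E_triangleD[OF E2]
  \<comment> \<open>Pulling \<open>eq\<close> back along the inclusion of \<open>C\<^sub>2\<close> identifies \<open>\<delta>''\<close>.\<close>
  have "\<delta>'' = pull \<C> (in2 s) E (pull \<C> (pr2 s) E \<delta>'')"
    using pull_Comp[OF sm(2,4) DE1(3)] sm(6) pull_Id[OF DE1(3)] by simp
  also have "\<dots> = push \<C> C\<^sub>2 e \<delta>\<^sub>2"
    using push_pull[OF DE2(1) sm(2) E_triangleD(3)[OF T]] eq i2 by simp
  finally have d'': "\<delta>'' = push \<C> C\<^sub>2 e \<delta>\<^sub>2" .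
  obtain a where a: "is_iso \<C> E B\<^sub>1 a" "a \<cdot> e = x\<^sub>1"
    using realization_unique[OF E2[unfolded i1] t1] by metis
  obtain a' where a': "a \<in> mor \<C> E B\<^sub>1" "a' \<in> mor \<C> B\<^sub>1 E" "a' \<cdot> a = Id \<C> E" "a \<cdot> a' = Id \<C> B\<^sub>1"
    using a(1) by (rule is_isoE)
  have "push \<C> C\<^sub>2 a (pull \<C> (Id \<C> C\<^sub>2) E \<delta>'') = push \<C> C\<^sub>2 x\<^sub>1 \<delta>\<^sub>2"
    using pull_Id[OF DE1(3)] d'' push_Comp[OF DE2(1) a'(1) d2] a(2) by simp
  then show ?thesis
    using that triangle_iso_transport[OF E1 a' Id_in_mor Id_in_mor] Comp_Id_left[OF Id_in_mor] by metis
qed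

lemma pushout_triangles:
  assumes t1: "(A, x\<^sub>1, B\<^sub>1, y\<^sub>1, C\<^sub>1, \<delta>\<^sub>1) \<in> E_triangles \<C>"
    and t2: "(A, x\<^sub>2, B\<^sub>2, y\<^sub>2, C\<^sub>2, \<delta>\<^sub>2) \<in> E_triangles \<C>"
  obtains V u w u' w' where "(B\<^sub>1, u, V, w, C\<^sub>2, push \<C> C\<^sub>2 x\<^sub>1 \<delta>\<^sub>2) \<in> E_triangles \<C>"
    "(B\<^sub>2, u', V, w', C\<^sub>1, push \<C> C\<^sub>1 x\<^sub>2 \<delta>\<^sub>1) \<in> E_triangles \<C>"
proof -
  note D1 = E_triangleD[OF t1] and D2 = E_triangleD[OF t2]
  obtain s where s: "is_biproduct \<C> C\<^sub>1 C\<^sub>2 s" using biproduct_exists by blast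
  let ?s' = "\<lparr>sumobj = sumobj s, in1 = in2 s, in2 = in1 s, pr1 = pr2 s, pr2 = pr1 s\<rparr>"
  have s': "is_biproduct \<C> C\<^sub>2 C\<^sub>1 ?s'" using is_biproduct_swap[OF s] .
  interpret G: comm_group "Ext \<C> (sumobj s) A" by (rule Ext_comm_group)
  let ?p1 = "pull \<C> (pr1 s) A \<delta>\<^sub>1" and ?p2 = "pull \<C> (pr2 s) A \<delta>\<^sub>2"
  have p: "?p1 \<in> ext \<C> (sumobj s) A" "?p2 \<in> ext \<C> (sumobj s) A"
    using pull_in_ext s D1 D2 unfolding is_biproduct_def by blast+
  then obtain v V q where
    T: "(A, v, V, q, sumobj s, ?p1 \<otimes>\<^bsub>Ext \<C> (sumobj s) A\<^esub> ?p2) \<in> E_triangles \<C>"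
    using realization_exists[OF G.m_closed] by metis
  have T': "(A, v, V, q, sumobj ?s', pull \<C> (pr1 ?s') A \<delta>\<^sub>2
      \<otimes>\<^bsub>Ext \<C> (sumobj ?s') A\<^esub> pull \<C> (pr2 ?s') A \<delta>\<^sub>1) \<in> E_triangles \<C>"
    using T G.m_comm[OF p] by simp
  from pushout_half[OF t1 D2(3) s T] pushout_half[OF t2 D1(3) s' T'] that show ?thesis by metis
qed

text \<open>The dual of the pushout: the middle term of \<open>in\<^sub>1\<^sub>*\<delta>\<^sub>1 + in\<^sub>2\<^sub>*\<delta>\<^sub>2\<close>, with the octahedral axiom applied
  to the inclusion of \<open>A\<^sub>2\<close> followed by the inflation into that middle term.\<close>

lemma pullback_half:
  assumes t1: "(A\<^sub>1, x\<^sub>1, B\<^sub>1, y\<^sub>1, C, \<delta>\<^sub>1) \<in> E_triangles \<C>"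
    and d2: "\<delta>\<^sub>2 \<in> ext \<C> C A\<^sub>2"
    and s: "is_biproduct \<C> A\<^sub>2 A\<^sub>1 s"
    and T: "(sumobj s, v, V, q, C, push \<C> C (in1 s) \<delta>\<^sub>2
              \<otimes>\<^bsub>Ext \<C> C (sumobj s)\<^esub> push \<C> C (in2 s) \<delta>\<^sub>1) \<in> E_triangles \<C>"
  obtains u w where "(A\<^sub>2, u, V, w, B\<^sub>1, pull \<C> y\<^sub>1 A\<^sub>2 \<delta>\<^sub>2) \<in> E_triangles \<C>"
proof -
  note D1 = E_triangleD[OF t1]
  have sm: "in1 s \<in> mor \<C> A\<^sub>2 (sumobj s)" "in2 s \<in> mor \<C> A\<^sub>1 (sumobj s)"
    "pr1 s \<in> mor \<C> (sumobj s) A\<^sub>2" "pr2 s \<in> mor \<C> (sumobj s) A\<^sub>1"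
    "pr1 s \<cdot> in1 s = Id \<C> A\<^sub>2" "pr2 s \<cdot> in2 s = Id \<C> A\<^sub>1"
    "pr2 s \<cdot> in1 s = zero_mor A\<^sub>2 A\<^sub>1" "pr1 s \<cdot> in2 s = zero_mor A\<^sub>1 A\<^sub>2"
    using s unfolding is_biproduct_def by auto
  let ?i2 = "push \<C> C (in1 s) \<delta>\<^sub>2" and ?i1 = "push \<C> C (in2 s) \<delta>\<^sub>1"
  let ?d = "?i2 \<otimes>\<^bsub>Ext \<C> C (sumobj s)\<^esub> ?i1"
  have p: "?i2 \<in> ext \<C> C (sumobj s)" "?i1 \<in> ext \<C> C (sumobj s)"
    using push_in_ext sm D1 d2 by blast+
  interpret G1: group "Ext \<C> C A\<^sub>1" by (rule Ext_group)
  interpret G2: group "Ext \<C> C A\<^sub>2" by (rule Ext_group)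
  have "push \<C> C (pr2 s) ?d = push \<C> C (pr2 s) ?i2 \<otimes>\<^bsub>Ext \<C> C A\<^sub>1\<^esub> push \<C> C (pr2 s) ?i1"
    using hom_mult[OF push_hom[OF sm(4)] p] .
  also have "push \<C> C (pr2 s) ?i2 = zero_ext C A\<^sub>1"
    using push_Comp[OF sm(1,4) d2] unfolding sm(7) push_zero_mor[OF d2] by (rule sym)
  also have "push \<C> C (pr2 s) ?i1 = \<delta>\<^sub>1"
    using push_Comp[OF sm(2,4) D1(3)] unfolding sm(6) push_Id[OF D1(3)] by (rule sym)
  also have "zero_ext C A\<^sub>1 \<otimes>\<^bsub>Ext \<C> C A\<^sub>1\<^esub> \<delta>\<^sub>1 = \<delta>\<^sub>1" using D1(3) by simp
  finally have i1: "push \<C> C (pr2 s) ?d = \<delta>\<^sub>1" .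
  have "push \<C> C (pr1 s) ?d = push \<C> C (pr1 s) ?i2 \<otimes>\<^bsub>Ext \<C> C A\<^sub>2\<^esub> push \<C> C (pr1 s) ?i1"
    using hom_mult[OF push_hom[OF sm(3)] p] .
  also have "push \<C> C (pr1 s) ?i2 = \<delta>\<^sub>2"
    using push_Comp[OF sm(1,3) d2] unfolding sm(5) push_Id[OF d2] by (rule sym)
  also have "push \<C> C (pr1 s) ?i1 = zero_ext C A\<^sub>2"
    using push_Comp[OF sm(2,3) D1(3)] unfolding sm(8) push_zero_mor[OF D1(3)] by (rule sym)
  also have "\<delta>\<^sub>2 \<otimes>\<^bsub>Ext \<C> C A\<^sub>2\<^esub> zero_ext C A\<^sub>2 = \<delta>\<^sub>2" using d2 by simp
  finally have i2: "push \<C> C (pr1 s) ?d = \<delta>\<^sub>2" .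
  from ET4[OF biproduct_triangle[OF s] T] obtain E h' \<delta>'' k e where
    E1: "(A\<^sub>2, v \<cdot> in1 s, V, h', E, \<delta>'') \<in> E_triangles \<C>" and
    E2: "(A\<^sub>1, k, E, e, C, push \<C> C (pr2 s) ?d) \<in> E_triangles \<C>" and
    eq: "push \<C> E (in1 s) \<delta>'' = pull \<C> e (sumobj s) ?d" by blast
  note DE1 = E_triangleD[OF E1] and DE2 = E_triangleD[OF E2]
  \<comment> \<open>Pushing \<open>eq\<close> out along the projection to \<open>A\<^sub>2\<close> identifies \<open>\<delta>''\<close>.\<close>
  have "\<delta>'' = push \<C> E (pr1 s) (push \<C> E (in1 s) \<delta>'')"
    using push_Comp[OF sm(1,3) DE1(3)] sm(5) push_Id[OF DE1(3)] by simp
  also have "\<dots> = pull \<C> e A\<^sub>2 \<delta>\<^sub>2"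
    using push_pull[OF sm(3) DE2(2) E_triangleD(3)[OF T]] eq i2 by simp
  finally have d'': "\<delta>'' = pull \<C> e A\<^sub>2 \<delta>\<^sub>2" .
  obtain b where b: "is_iso \<C> B\<^sub>1 E b" "e \<cdot> b = y\<^sub>1"
    using realization_unique[OF t1 E2[unfolded i1]] by metis
  obtain b' where b': "b \<in> mor \<C> B\<^sub>1 E" "b' \<in> mor \<C> E B\<^sub>1" "b' \<cdot> b = Id \<C> B\<^sub>1" "b \<cdot> b' = Id \<C> E"
    using b(1) by (rule is_isoE)
  have "push \<C> B\<^sub>1 (Id \<C> A\<^sub>2) (pull \<C> b A\<^sub>2 \<delta>'') = pull \<C> y\<^sub>1 A\<^sub>2 \<delta>\<^sub>2"
    using push_Id[OF pull_in_ext[OF b'(1) DE1(3)]] d'' pull_Comp[OF b'(1) DE2(2) d2] b(2) by simp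
  then show ?thesis
    using that triangle_iso_transport[OF E1 Id_in_mor Id_in_mor _ _ b'(2,1,4,3)]
      Comp_Id_left[OF Id_in_mor] by metis
qed

lemma pullback_triangles:
  assumes t1: "(A\<^sub>1, x\<^sub>1, B\<^sub>1, y\<^sub>1, C, \<delta>\<^sub>1) \<in> E_triangles \<C>"
    and t2: "(A\<^sub>2, x\<^sub>2, B\<^sub>2, y\<^sub>2, C, \<delta>\<^sub>2) \<in> E_triangles \<C>"
  obtains V u w u' w' where "(A\<^sub>2, u, V, w, B\<^sub>1, pull \<C> y\<^sub>1 A\<^sub>2 \<delta>\<^sub>2) \<in> E_triangles \<C>"
    "(A\<^sub>1, u', V, w', B\<^sub>2, pull \<C> y\<^sub>2 A\<^sub>1 \<delta>\<^sub>1) \<in> E_triangles \<C>"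
proof -
  note D1 = E_triangleD[OF t1] and D2 = E_triangleD[OF t2]
  obtain s where s: "is_biproduct \<C> A\<^sub>2 A\<^sub>1 s" using biproduct_exists by blast
  let ?s' = "\<lparr>sumobj = sumobj s, in1 = in2 s, in2 = in1 s, pr1 = pr2 s, pr2 = pr1 s\<rparr>"
  have s': "is_biproduct \<C> A\<^sub>1 A\<^sub>2 ?s'" using is_biproduct_swap[OF s] .
  interpret G: comm_group "Ext \<C> C (sumobj s)" by (rule Ext_comm_group)
  let ?i2 = "push \<C> C (in1 s) \<delta>\<^sub>2" and ?i1 = "push \<C> C (in2 s) \<delta>\<^sub>1"
  have p: "?i2 \<in> ext \<C> C (sumobj s)" "?i1 \<in> ext \<C> C (sumobj s)"
    using push_in_ext s D1 D2 unfolding is_biproduct_def by blast+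
  then obtain v V q where
    T: "(sumobj s, v, V, q, C, ?i2 \<otimes>\<^bsub>Ext \<C> C (sumobj s)\<^esub> ?i1) \<in> E_triangles \<C>"
    using realization_exists[OF G.m_closed] by metis
  have T': "(sumobj ?s', v, V, q, C, push \<C> C (in1 ?s') \<delta>\<^sub>1
      \<otimes>\<^bsub>Ext \<C> C (sumobj ?s')\<^esub> push \<C> C (in2 ?s') \<delta>\<^sub>2) \<in> E_triangles \<C>"
    using T G.m_comm[OF p] by simp
  from pullback_half[OF t1 D2(3) s T] pullback_half[OF t2 D1(3) s' T'] that show ?thesis by metis
qed

end

section \<open>Proper classes\<close>

locale extriangulated_proper_class = extriangulated_category \<C> + proper_class \<C> \<xi>
  for \<C> :: "('o, 'm, 'e) extri" (structure) and \<xi> :: "('o, 'm, 'e) etri set"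
begin

lemma xi_triangle: "T \<in> \<xi> \<Longrightarrow> T \<in> E_triangles \<C>"
  using proper_subset by blast

text \<open>The dual of saturation.  As \<open>u\<close> is the deflation of a realization of \<open>x\<^sub>*\<epsilon>\<close>, it kills \<open>x\<^sub>*\<epsilon>\<close>.  Then
  \<open>x\<^sub>*u\<^sup>*\<epsilon> = u\<^sup>*x\<^sub>*\<epsilon> = 0\<close>, so \<open>u\<^sup>*\<epsilon>\<close> is a base change of \<open>\<delta>\<close> and lies in \<open>\<xi>\<close>; since \<open>u\<close> is a deflation of \<open>\<xi>\<close>, saturation applies.\<close>

lemma cosaturated:
  assumes t: "(A, v, V, w, U, \<epsilon>) \<in> E_triangles \<C>"
    and d: "(A, x, B, y, C, \<delta>) \<in> \<xi>"
    and p: "(B, x', B', u, U, push \<C> U x \<epsilon>) \<in> \<xi>"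
  shows "(A, v, V, w, U, \<epsilon>) \<in> \<xi>"
proof -
  note D = E_triangleD[OF xi_triangle[OF d]] and P = E_triangleD[OF xi_triangle[OF p]]
    and T = E_triangleD[OF t]
  have ue: "pull \<C> u A \<epsilon> \<in> ext \<C> B' A" using pull_in_ext[OF P(2) T(3)] .
  have "push \<C> B' x (pull \<C> u A \<epsilon>) = zero_ext B' B"
    using push_pull[OF D(1) P(2) T(3)] pull_deflation_zero[OF xi_triangle[OF p]] by simp
  then obtain c where c: "c \<in> mor \<C> B' C" "pull \<C> u A \<epsilon> = pull \<C> c A \<delta>"
    using killed_by_inflation_is_pullback[OF xi_triangle[OF d] ue] by metis
  obtain a E b where "(A, a, E, b, B', pull \<C> u A \<epsilon>) \<in> E_triangles \<C>"
    using ue by (rule realization_exists)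
  then have "(A, a, E, b, B', pull \<C> u A \<epsilon>) \<in> \<xi>"
    using base_change[OF d c(1)] c(2) by metis
  from saturated[OF t p this] show ?thesis .
qed

text \<open>Both extensions \<open>f\<^sub>*\<delta>'' = e\<^sup>*\<delta>'\<close> and \<open>\<delta>\<close> are in \<open>\<xi>\<close>, so cosaturation applies to \<open>\<delta>''\<close>.\<close>

lemma xi_octahedron:
  assumes 1: "(A, f, B, f', D, \<delta>) \<in> \<xi>" and 2: "(B, g, C, g', F, \<delta>') \<in> \<xi>"
  obtains E h' \<delta>'' d e \<epsilon> where "(A, g \<cdot> f, C, h', E, \<delta>'') \<in> \<xi>" "(D, d, E, e, F, \<epsilon>) \<in> \<xi>"
proof -
  from ET4[OF xi_triangle[OF 1] xi_triangle[OF 2]] obtain E h' \<delta>'' d e where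
    T: "(A, g \<cdot> f, C, h', E, \<delta>'') \<in> E_triangles \<C>" and
    T': "(D, d, E, e, F, push \<C> F f' \<delta>') \<in> E_triangles \<C>" and
    eq: "push \<C> E f \<delta>'' = pull \<C> e B \<delta>'" by blast
  note D1 = E_triangleD[OF xi_triangle[OF 1]] and D2 = E_triangleD[OF xi_triangle[OF 2]]
    and DT = E_triangleD[OF T] and DT' = E_triangleD[OF T']
  obtain x' B' u where p: "(B, x', B', u, E, pull \<C> e B \<delta>') \<in> E_triangles \<C>"
    using pull_in_ext[OF DT'(2) D2(3)] by (rule realization_exists)
  have "(B, x', B', u, E, push \<C> E f \<delta>'') \<in> \<xi>"
    using base_change[OF 2 DT'(2) p] eq by simp
  from cosaturated[OF T 1 this] that cobase_change[OF 2 D1(2) T'] show ?thesis by blast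
qed

lemma xi_octahedron_op:
  assumes 1: "(D, f', B, f, A, \<delta>) \<in> \<xi>" and 2: "(F, g', C, g, B, \<delta>') \<in> \<xi>"
  obtains E h' \<delta>'' d e \<epsilon> where "(E, h', C, f \<cdot> g, A, \<delta>'') \<in> \<xi>" "(F, e, E, d, D, \<epsilon>) \<in> \<xi>"
proof -
  from ET4_op[OF xi_triangle[OF 1] xi_triangle[OF 2]] obtain E h' \<delta>'' d e where
    T: "(E, h', C, f \<cdot> g, A, \<delta>'') \<in> E_triangles \<C>" and
    T': "(F, e, E, d, D, pull \<C> f' F \<delta>') \<in> E_triangles \<C>" and
    eq: "pull \<C> f E \<delta>'' = push \<C> B e \<delta>'" by blast
  note D1 = E_triangleD[OF xi_triangle[OF 1]] and D2 = E_triangleD[OF xi_triangle[OF 2]]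
    and DT' = E_triangleD[OF T']
  obtain x' B' u where p: "(E, x', B', u, B, push \<C> B e \<delta>') \<in> E_triangles \<C>"
    using push_in_ext[OF DT'(1) D2(3)] by (rule realization_exists)
  have "(E, x', B', u, B, pull \<C> f E \<delta>'') \<in> \<xi>"
    using cobase_change[OF 2 DT'(1) p] eq by simp
  from saturated[OF T 1 this] that base_change[OF 2 D1(1) T'] show ?thesis by blast
qed

lemma xi_pushout:
  assumes 1: "(A, x\<^sub>1, B\<^sub>1, y\<^sub>1, C\<^sub>1, \<delta>\<^sub>1) \<in> \<xi>" and 2: "(A, x\<^sub>2, B\<^sub>2, y\<^sub>2, C\<^sub>2, \<delta>\<^sub>2) \<in> \<xi>"
  obtains V u w u' w' \<epsilon> \<epsilon>' where "(B\<^sub>1, u, V, w, C\<^sub>2, \<epsilon>) \<in> \<xi>" "(B\<^sub>2, u', V, w', C\<^sub>1, \<epsilon>') \<in> \<xi>"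
proof -
  note x1 = E_triangleD(1)[OF xi_triangle[OF 1]] and x2 = E_triangleD(1)[OF xi_triangle[OF 2]]
  from pushout_triangles[OF xi_triangle[OF 1] xi_triangle[OF 2]] show ?thesis
    using that cobase_change[OF 1 x2] cobase_change[OF 2 x1] by metis
qed

lemma xi_pullback:
  assumes 1: "(A\<^sub>1, x\<^sub>1, B\<^sub>1, y\<^sub>1, C, \<delta>\<^sub>1) \<in> \<xi>" and 2: "(A\<^sub>2, x\<^sub>2, B\<^sub>2, y\<^sub>2, C, \<delta>\<^sub>2) \<in> \<xi>"
  obtains V u w u' w' \<epsilon> \<epsilon>' where "(A\<^sub>2, u, V, w, B\<^sub>1, \<epsilon>) \<in> \<xi>" "(A\<^sub>1, u', V, w', B\<^sub>2, \<epsilon>') \<in> \<xi>"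
proof -
  note y1 = E_triangleD(2)[OF xi_triangle[OF 1]] and y2 = E_triangleD(2)[OF xi_triangle[OF 2]]
  from pullback_triangles[OF xi_triangle[OF 1] xi_triangle[OF 2]] show ?thesis
    using that base_change[OF 1 y2] base_change[OF 2 y1] by metis
qed

end

section \<open>Resolutions\<close>

text \<open>A bounded \<open>\<xi>\<close>-exact complex with its maps forgotten and its \<open>i\<close>-th term required to lie in \<open>\<Y> i\<close>.
  The varying class covers resolutions by \<open>\<X>\<close>, by \<open>\<H>\<close> and the mixed ones alike, and recursion over
  the first syzygy makes the inductions below act on the object \<open>M\<close>.  A resolution of length \<open>0\<close> is
  \<open>M\<close> itself.\<close>

primrec resolved_by ::
  "('o, 'm, 'e) etri set \<Rightarrow> nat \<Rightarrow> (nat \<Rightarrow> 'o set) \<Rightarrow> 'o \<Rightarrow> bool" where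
  "resolved_by \<xi> 0 \<Y> M \<longleftrightarrow> M \<in> \<Y> 0"
| "resolved_by \<xi> (Suc n) \<Y> M \<longleftrightarrow>
     (\<exists>K x Y y \<delta>. (K, x, Y, y, M, \<delta>) \<in> \<xi> \<and> Y \<in> \<Y> 0 \<and> resolved_by \<xi> n (\<lambda>i. \<Y> (Suc i)) K)"

lemma resolved_by_SucI:
  "(K, x, Y, y, M, \<delta>) \<in> \<xi> \<Longrightarrow> Y \<in> \<Y> 0 \<Longrightarrow> resolved_by \<xi> n (\<lambda>i. \<Y> (Suc i)) K \<Longrightarrow>
     resolved_by \<xi> (Suc n) \<Y> M"
  unfolding resolved_by.simps by blast

lemma resolved_by_if_exact_bounded:
  assumes "xi_exact_bounded \<C> \<xi> n Y d M" "\<forall>i\<le>n. Y i \<in> \<Y> i"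
  shows "resolved_by \<xi> n \<Y> M"
proof -
  obtain K g f \<delta> where K: "K 0 = M" "K n = Y n"
    "\<forall>i<n. (K (Suc i), g i, Y i, f i, K i, \<delta> i) \<in> \<xi>"
    using assms(1) unfolding xi_exact_bounded_def by blast
  have "resolved_by \<xi> n \<Y> (K 0)"
    using K(2,3) assms(2)
  proof (induction n arbitrary: K Y g f \<delta> \<Y>)
    case (Suc n)
    have "resolved_by \<xi> n (\<lambda>i. \<Y> (Suc i)) (K (Suc 0))"
      using Suc.IH[of "\<lambda>i. K (Suc i)" "\<lambda>i. Y (Suc i)" "\<lambda>i. g (Suc i)" "\<lambda>i. f (Suc i)"
          "\<lambda>i. \<delta> (Suc i)" "\<lambda>i. \<Y> (Suc i)"] Suc.prems by simp
    moreover have "(K (Suc 0), g 0, Y 0, f 0, K 0, \<delta> 0) \<in> \<xi>" "Y 0 \<in> \<Y> 0" using Suc.prems by auto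
    ultimately show ?case by (intro resolved_by_SucI)
  qed simp
  then show ?thesis using K(1) by simp
qed

lemma exact_bounded_Cons:
  assumes t: "(K, x, X, y, M, \<delta>) \<in> \<xi>" and e: "xi_exact_bounded \<C> \<xi> n Y d K"
  shows "\<exists>d'. xi_exact_bounded \<C> \<xi> (Suc n) (case_nat X Y) d' M"
proof -
  obtain L g f \<epsilon> where L: "L 0 = K" "L n = Y n" "f n = Id \<C> (Y n)"
    "\<forall>i<n. (L (Suc i), g i, Y i, f i, L i, \<epsilon> i) \<in> \<xi>"
    using e unfolding xi_exact_bounded_def by blast
  define g' f' where "g' = case_nat x g" and "f' = case_nat y f"
  have "\<forall>i<Suc n. (case_nat M L (Suc i), g' i, case_nat X Y i, f' i, case_nat M L i, case_nat \<delta> \<epsilon> i) \<in> \<xi>"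
    using L t by (auto simp: g'_def f'_def split: nat.split)
  moreover have "case_nat M L 0 = M" "case_nat M L (Suc n) = case_nat X Y (Suc n)"
    "f' (Suc n) = Id \<C> (case_nat X Y (Suc n))"
    using L by (simp_all add: f'_def)
  ultimately have "xi_exact_bounded \<C> \<xi> (Suc n) (case_nat X Y)
      (case_nat (f' 0) (\<lambda>i. g' i \<cdot>\<^bsub>\<C>\<^esub> f' (Suc i))) M"
    unfolding xi_exact_bounded_def
    by (intro exI[of _ "case_nat M L"] exI[of _ g'] exI[of _ f'] exI[of _ "case_nat \<delta> \<epsilon>"]) auto
  then show ?thesis by blast
qed

lemma resolved_by_iff_exact_bounded:
  "resolved_by \<xi> n \<Y> M \<longleftrightarrow> (\<exists>Y d. xi_exact_bounded \<C> \<xi> n Y d M \<and> (\<forall>i\<le>n. Y i \<in> \<Y> i))"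
proof
  show "resolved_by \<xi> n \<Y> M \<Longrightarrow> \<exists>Y d. xi_exact_bounded \<C> \<xi> n Y d M \<and> (\<forall>i\<le>n. Y i \<in> \<Y> i)"
  proof (induction n arbitrary: M \<Y>)
    case 0
    have "xi_exact_bounded \<C> \<xi> 0 (\<lambda>_. M) (\<lambda>_. Id \<C> M) M"
      unfolding xi_exact_bounded_def by (intro exI[of _ "\<lambda>_. M"] exI[of _ "\<lambda>_. Id \<C> M"]) auto
    then show ?case using 0 by auto
  next
    case (Suc n)
    obtain K x X y \<delta> where t: "(K, x, X, y, M, \<delta>) \<in> \<xi>" "X \<in> \<Y> 0"
      and r: "resolved_by \<xi> n (\<lambda>i. \<Y> (Suc i)) K" using Suc.prems by auto
    from Suc.IH[OF r] obtain Y d where e: "xi_exact_bounded \<C> \<xi> n Y d K" "\<forall>i\<le>n. Y i \<in> \<Y> (Suc i)"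
      by blast
    have "\<forall>i\<le>Suc n. case_nat X Y i \<in> \<Y> i" using t e by (auto split: nat.split)
    then show ?case using exact_bounded_Cons[OF t(1) e(1)] by blast
  qed
qed (elim exE conjE, rule resolved_by_if_exact_bounded)

lemma resolved_by_mono:
  "resolved_by \<xi> n \<Y> M \<Longrightarrow> (\<And>i. i \<le> n \<Longrightarrow> \<Y> i \<subseteq> \<Y>' i) \<Longrightarrow> resolved_by \<xi> n \<Y>' M"
proof (induction n arbitrary: M \<Y> \<Y>')
  case (Suc n)
  obtain K x X y \<delta> where t: "(K, x, X, y, M, \<delta>) \<in> \<xi>" "X \<in> \<Y> 0"
    and r: "resolved_by \<xi> n (\<lambda>i. \<Y> (Suc i)) K" using Suc.prems(1) by auto
  have "resolved_by \<xi> n (\<lambda>i. \<Y>' (Suc i)) K" using Suc.IH[OF r] Suc.prems(2) by simp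
  then show ?case using t Suc.prems(2)[of 0] by (blast intro: resolved_by_SucI)
qed auto

context extriangulated_proper_class
begin

text \<open>The last syzygy \<open>N\<close> has the split triangle \<open>0 \<rightarrow> N \<rightarrow> N\<close>, which makes the resolution longer by a
  zero term.\<close>

lemma resolved_by_pad:
  assumes Z: "is_zero_object \<C> Z" "Z \<in> \<Y>" and r: "resolved_by \<xi> k (\<lambda>_. \<Y>) M" and "k \<le> n"
  shows "resolved_by \<xi> n (\<lambda>_. \<Y>) M"
proof -
  have step: "resolved_by \<xi> m (\<lambda>_. \<Y>) N \<Longrightarrow> resolved_by \<xi> (Suc m) (\<lambda>_. \<Y>) N" for m N
  proof (induction m arbitrary: N)
    case 0
    have "(Z, zero_mor Z N, N, Id \<C> N, N, zero_ext N Z) \<in> \<xi>"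
      using split_in iso_triangle_from_zero[OF Z(1) is_iso_Id] by blast
    then show ?case by (rule resolved_by_SucI) (use 0 Z(2) in simp_all)
  next
    case (Suc m)
    then obtain K x Y y \<delta> where t: "(K, x, Y, y, N, \<delta>) \<in> \<xi>" "Y \<in> \<Y>" "resolved_by \<xi> m (\<lambda>_. \<Y>) K"
      by auto
    show ?case by (rule resolved_by_SucI[OF t(1,2) Suc.IH[OF t(3)]])
  qed
  show ?thesis using \<open>k \<le> n\<close> r step by (induction rule: dec_induct) blast+
qed

lemma res_dim_le_iff:
  assumes "additive_subcategory \<C> \<Y>"
  shows "res_dim \<C> \<xi> \<Y> M \<le> enat n \<longleftrightarrow> resolved_by \<xi> n (\<lambda>_. \<Y>) M"
proof -
  let ?S = "{enat n | n. resolved_by \<xi> n (\<lambda>_. \<Y>) M}"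
  have dim: "res_dim \<C> \<xi> \<Y> M = Inf ?S"
    unfolding res_dim_def using resolved_by_iff_exact_bounded[of \<xi> _ "\<lambda>_. \<Y>" M \<C>]
    by (metis (no_types, lifting))
  obtain Z where Z: "is_zero_object \<C> Z" "Z \<in> \<Y>"
    using assms unfolding additive_subcategory_def by blast
  show ?thesis
  proof
    assume le: "res_dim \<C> \<xi> \<Y> M \<le> enat n"
    have "?S \<noteq> {}"
    proof
      assume "?S = {}"
      then have "res_dim \<C> \<xi> \<Y> M = \<infinity>" using dim by (simp add: Inf_enat_def)
      then show False using le by simp
    qed
    then have "Inf ?S \<in> ?S" using LeastI_ex[of "\<lambda>x. x \<in> ?S"] by (auto simp: Inf_enat_def)
    then obtain k where "Inf ?S = enat k" "resolved_by \<xi> k (\<lambda>_. \<Y>) M" by auto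
    then show "resolved_by \<xi> n (\<lambda>_. \<Y>) M" using resolved_by_pad[OF Z] le dim by simp
  next
    assume "resolved_by \<xi> n (\<lambda>_. \<Y>) M"
    then show "res_dim \<C> \<xi> \<Y> M \<le> enat n" unfolding dim by (intro Inf_lower) blast
  qed
qed

end

section \<open>Approximation by a quasi-resolving subcategory\<close>

locale quasi_resolving_subcategory = extriangulated_proper_class \<C> \<xi>
  for \<C> :: "('o, 'm, 'e) extri" (structure) and \<xi> :: "('o, 'm, 'e) etri set" +
  fixes \<X> :: "'o set"
  assumes quasi_resolving: "quasi_resolving \<C> \<xi> \<X>"
begin

lemma extension_closed: "(A, x, B, y, C, \<delta>) \<in> \<xi> \<Longrightarrow> A \<in> \<X> \<Longrightarrow> C \<in> \<X> \<Longrightarrow> B \<in> \<X>"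
  using quasi_resolving unfolding quasi_resolving_def by blast

lemma cocone_closed: "(A, x, B, y, C, \<delta>) \<in> \<xi> \<Longrightarrow> B \<in> \<X> \<Longrightarrow> C \<in> \<X> \<Longrightarrow> A \<in> \<X>"
  using quasi_resolving unfolding quasi_resolving_def by blast

lemma enough_projectives_in:
  assumes "X \<in> \<X>"
  obtains K x P y \<delta> where "(K, x, P, y, X, \<delta>) \<in> \<xi>" "P \<in> projectives_in \<C> \<xi> \<X>" "K \<in> \<X>"
proof -
  obtain Y d where Y: "\<forall>i. Y i \<in> projectives_in \<C> \<xi> \<X>" "xi_exact_left_unbounded \<C> \<xi> Y d X"
    using assms quasi_resolving unfolding quasi_resolving_def res_def by blast
  then obtain K g f \<delta> where "K 0 = X" "\<forall>i. (K (Suc i), g i, Y i, f i, K i, \<delta> i) \<in> \<xi>"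
    unfolding xi_exact_left_unbounded_def by blast
  then have "(K (Suc 0), g 0, Y 0, f 0, X, \<delta> 0) \<in> \<xi>" by metis
  moreover have "Y 0 \<in> projectives_in \<C> \<xi> \<X>" using Y by blast
  moreover have "K (Suc 0) \<in> \<X>"
    using cocone_closed calculation assms unfolding projectives_in_def by blast
  ultimately show ?thesis using that by blast
qed

text \<open>Pull the first step \<open>X\<^sub>0 \<rightarrow> N\<close> of a resolution of \<open>N\<close> back along \<open>E \<rightarrow> N\<close>: the pullback is an extension
  of \<open>X\<^sub>0\<close> by \<open>Q\<close>, hence in \<open>\<X>\<close>, and maps onto \<open>E\<close> with the old first syzygy as kernel.\<close>

lemma resolved_extension:
  assumes t: "(Q, q, E, p, N, \<delta>) \<in> \<xi>" and Q: "Q \<in> \<X>" and r: "resolved_by \<xi> n (\<lambda>_. \<X>) N"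
  shows "resolved_by \<xi> n (\<lambda>_. \<X>) E"
proof (cases n)
  case 0
  then show ?thesis using r extension_closed[OF t Q] by simp
next
  case (Suc m)
  then obtain K k X y \<epsilon> where 2: "(K, k, X, y, N, \<epsilon>) \<in> \<xi>" "X \<in> \<X>" "resolved_by \<xi> m (\<lambda>_. \<X>) K"
    using r by auto
  obtain V u w u' w' \<epsilon> \<epsilon>' where V: "(K, u, V, w, E, \<epsilon>) \<in> \<xi>" "(Q, u', V, w', X, \<epsilon>') \<in> \<xi>"
    using xi_pullback[OF t 2(1)] .
  have "V \<in> \<X>" using extension_closed[OF V(2) Q 2(2)] .
  then show ?thesis unfolding Suc using V(1) 2(3) by (blast intro: resolved_by_SucI)
qed

text \<open>Replace \<open>X\<^sub>0 \<rightarrow> M\<close> by \<open>P \<rightarrow> X\<^sub>0 \<rightarrow> M\<close>.  The new syzygy is an extension of the old one by the kernel of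
  \<open>P \<rightarrow> X\<^sub>0\<close>, which lies in \<open>\<X>\<close>.\<close>

lemma projective_first_step:
  assumes "resolved_by \<xi> (Suc n) (\<lambda>_. \<X>) M"
  obtains K x P y \<delta> where "(K, x, P, y, M, \<delta>) \<in> \<xi>" "P \<in> projectives_in \<C> \<xi> \<X>"
    "resolved_by \<xi> n (\<lambda>_. \<X>) K"
proof -
  obtain K x X y \<delta> where 1: "(K, x, X, y, M, \<delta>) \<in> \<xi>" "X \<in> \<X>" "resolved_by \<xi> n (\<lambda>_. \<X>) K"
    using assms by auto
  obtain Q q P p \<epsilon> where 2: "(Q, q, P, p, X, \<epsilon>) \<in> \<xi>" "P \<in> projectives_in \<C> \<xi> \<X>" "Q \<in> \<X>"
    using enough_projectives_in[OF 1(2)] .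
  obtain E h' \<delta>'' d e \<epsilon>' where E: "(E, h', P, y \<cdot> p, M, \<delta>'') \<in> \<xi>" "(Q, e, E, d, K, \<epsilon>') \<in> \<xi>"
    using xi_octahedron_op[OF 1(1) 2(1)] .
  show ?thesis using that[OF E(1) 2(2) resolved_extension[OF E(2) 2(3) 1(3)]] .
qed

text \<open>Compose the first step \<open>X\<^sub>0 \<rightarrow> W\<close> with \<open>W \<rightarrow> X\<close>: the kernel of the composite lies in \<open>\<X>\<close> and maps onto
  \<open>M\<close> with the same syzygy.\<close>

lemma resolved_cocone:
  assumes t: "(M, x, W, y, X, \<delta>) \<in> \<xi>" and X: "X \<in> \<X>" and r: "resolved_by \<xi> n (\<lambda>_. \<X>) W"
  shows "resolved_by \<xi> n (\<lambda>_. \<X>) M"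
proof (cases n)
  case 0
  then show ?thesis using r cocone_closed[OF t _ X] by simp
next
  case (Suc m)
  then obtain K k X\<^sub>0 p \<epsilon> where 2: "(K, k, X\<^sub>0, p, W, \<epsilon>) \<in> \<xi>" "X\<^sub>0 \<in> \<X>" "resolved_by \<xi> m (\<lambda>_. \<X>) K"
    using r by auto
  obtain E h' \<delta>'' d e \<epsilon>' where E: "(E, h', X\<^sub>0, y \<cdot> p, X, \<delta>'') \<in> \<xi>" "(K, e, E, d, M, \<epsilon>') \<in> \<xi>"
    using xi_octahedron_op[OF t 2(1)] .
  have "E \<in> \<X>" using cocone_closed[OF E(1) 2(2) X] .
  then show ?thesis unfolding Suc using E(2) 2(3) by (blast intro: resolved_by_SucI)
qed

text \<open>The pushout of \<open>K \<rightarrow> X\<^sub>0\<close> and \<open>K \<rightarrow> W\<close> is an extension of \<open>X'\<close> by \<open>X\<^sub>0\<close>.\<close>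

lemma replace_kernel:
  assumes 1: "(K, k, X\<^sub>0, p, M, \<delta>) \<in> \<xi>" "X\<^sub>0 \<in> \<X>" and 2: "(K, x, W, y, X', \<epsilon>) \<in> \<xi>" "X' \<in> \<X>"
  obtains u U v \<delta>' where "(W, u, U, v, M, \<delta>') \<in> \<xi>" "U \<in> \<X>"
  using xi_pushout[OF 1(1) 2(1)] extension_closed 1(2) 2(2) that by metis

context
  fixes \<H> :: "'o set"
  assumes cogen: "xi_cogenerator \<C> \<xi> \<H> \<X>"
begin

text \<open>Induction on \<open>n\<close>.  With \<open>K \<rightarrow> W \<rightarrow> X'\<close> for the first syzygy \<open>K\<close>, there is \<open>W \<rightarrow> U \<rightarrow> M\<close> with \<open>U \<in> \<X>\<close>.
  Embedding \<open>U\<close> in some \<open>H \<in> \<H>\<close> and composing, the cokernel of \<open>W \<rightarrow> U \<rightarrow> H\<close> contains \<open>M\<close> and is resolved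
  by \<open>\<H>\<close>.\<close>

lemma hull_exists:
  assumes "resolved_by \<xi> n (\<lambda>_. \<X>) M"
  shows "\<exists>x W y X \<delta>. (M, x, W, y, X, \<delta>) \<in> \<xi> \<and> X \<in> \<X> \<and> resolved_by \<xi> n (\<lambda>_. \<H>) W"
  using assms
proof (induction n arbitrary: M)
  case 0
  then show ?case using cogen unfolding xi_cogenerator_def by simp blast
next
  case (Suc n)
  obtain K k X\<^sub>0 p \<delta> where 1: "(K, k, X\<^sub>0, p, M, \<delta>) \<in> \<xi>" "X\<^sub>0 \<in> \<X>" "resolved_by \<xi> n (\<lambda>_. \<X>) K"
    using Suc.prems by auto
  obtain x W y X' \<epsilon> where 2: "(K, x, W, y, X', \<epsilon>) \<in> \<xi>" "X' \<in> \<X>" "resolved_by \<xi> n (\<lambda>_. \<H>) W"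
    using Suc.IH[OF 1(3)] by blast
  obtain u U v \<delta>' where 3: "(W, u, U, v, M, \<delta>') \<in> \<xi>" "U \<in> \<X>"
    using replace_kernel[OF 1(1,2) 2(1,2)] .
  obtain h H z X'' \<epsilon>' where 4: "(U, h, H, z, X'', \<epsilon>') \<in> \<xi>" "H \<in> \<H>" "X'' \<in> \<X>"
    using 3(2) cogen unfolding xi_cogenerator_def by metis
  obtain E h' \<delta>'' d e \<epsilon>'' where E: "(W, h \<cdot> u, H, h', E, \<delta>'') \<in> \<xi>" "(M, d, E, e, X'', \<epsilon>'') \<in> \<xi>"
    using xi_octahedron[OF 3(1) 4(1)] .
  have "resolved_by \<xi> (Suc n) (\<lambda>_. \<H>) E" using E(1) 4(2) 2(3) by (blast intro: resolved_by_SucI)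
  then show ?case using E(2) 4(3) by blast
qed

text \<open>The middle term \<open>U\<close> above, with the \<open>\<H>\<close>-resolution of its kernel \<open>W\<close>.\<close>

lemma approximation_exists:
  assumes "resolved_by \<xi> n (\<lambda>_. \<X>) M"
  shows "resolved_by \<xi> n (\<lambda>i. if i = 0 then \<X> else \<H>) M"
proof (cases n)
  case 0
  then show ?thesis using assms by simp
next
  case (Suc m)
  obtain K k X\<^sub>0 p \<delta> where 1: "(K, k, X\<^sub>0, p, M, \<delta>) \<in> \<xi>" "X\<^sub>0 \<in> \<X>" "resolved_by \<xi> m (\<lambda>_. \<X>) K"
    using assms Suc by auto
  obtain x W y X' \<epsilon> where 2: "(K, x, W, y, X', \<epsilon>) \<in> \<xi>" "X' \<in> \<X>" "resolved_by \<xi> m (\<lambda>_. \<H>) W"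
    using hull_exists[OF 1(3)] by blast
  obtain u U v \<delta>' where "(W, u, U, v, M, \<delta>') \<in> \<xi>" "U \<in> \<X>"
    using replace_kernel[OF 1(1,2) 2(1,2)] .
  then show ?thesis unfolding Suc using 2(3) by (auto intro!: resolved_by_SucI simp del: resolved_by.simps)
qed

lemma approximation_after_projectives:
  assumes "resolved_by \<xi> n (\<lambda>_. \<X>) M" "m \<le> n"
  shows "resolved_by \<xi> n (\<lambda>i. if i < m then projectives_in \<C> \<xi> \<X> else if i = m then \<X> else \<H>) M"
  using assms
proof (induction m arbitrary: n M)
  case 0
  then show ?case using approximation_exists by simp
next
  case (Suc m)
  then obtain n' where n: "n = Suc n'" "m \<le> n'" by (cases n) auto
  obtain K x P y \<delta> where t: "(K, x, P, y, M, \<delta>) \<in> \<xi>" "P \<in> projectives_in \<C> \<xi> \<X>"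
    "resolved_by \<xi> n' (\<lambda>_. \<X>) K"
    using projective_first_step Suc.prems(1) n(1) by blast
  have "(\<lambda>i. if Suc i < Suc m then projectives_in \<C> \<xi> \<X> else if Suc i = Suc m then \<X> else \<H>)
      = (\<lambda>i. if i < m then projectives_in \<C> \<xi> \<X> else if i = m then \<X> else \<H>)"
    by (rule ext) simp
  then show ?case
    unfolding n(1) using Suc.IH[OF t(3) n(2)] t(2) by (intro resolved_by_SucI[OF t(1)]) simp_all
qed

end

end

section \<open>Characterizations of the resolution dimension\<close>

theorem theorem4p6:
  fixes \<C> :: "('o, 'm, 'e) extri"
    and \<xi> :: "('o, 'm, 'e) etri set"
    and \<X> \<H> :: "'o set"
    and M :: 'o
    and n :: nat
  assumes "extriangulated_category \<C>"
    and "WIC \<C>"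
    and "proper_class \<C> \<xi>"
    and "enough_xi_projectives \<C> \<xi>"
    and "enough_xi_injectives \<C> \<xi>"
    and "quasi_resolving \<C> \<xi> \<X>"
    and "xi_cogenerator \<C> \<xi> \<H> \<X>"
    and "res_dim \<C> \<xi> \<X> M < \<infinity>"
  shows "(res_dim \<C> \<xi> \<X> M \<le> enat n \<longleftrightarrow>
            (\<exists>Y d. xi_exact_bounded \<C> \<xi> n Y d M \<and>
               Y 0 \<in> \<X> \<and> (\<forall>i. 1 \<le> i \<and> i \<le> n \<longrightarrow> Y i \<in> \<H>)))
       \<and> (res_dim \<C> \<xi> \<X> M \<le> enat n \<longleftrightarrow>
            (\<exists>x W y X \<delta>. (M, x, W, y, X, \<delta>) \<in> \<xi> \<and> X \<in> \<X> \<and> res_dim \<C> \<xi> \<H> W \<le> enat n))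
       \<and> (res_dim \<C> \<xi> \<X> M \<le> enat n \<longleftrightarrow>
            (\<forall>m\<le>n. \<exists>Y d. xi_exact_bounded \<C> \<xi> n Y d M \<and>
               (\<forall>j<m. Y j \<in> projectives_in \<C> \<xi> \<X>) \<and> Y m \<in> \<X> \<and>
               (\<forall>i. m + 1 \<le> i \<and> i \<le> n \<longrightarrow> Y i \<in> \<H>)))"
proof -
  interpret extriangulated_category \<C> by (rule assms(1))
  interpret proper_class \<C> \<xi> by (rule assms(3))
  interpret extriangulated_proper_class \<C> \<xi> ..
  interpret quasi_resolving_subcategory \<C> \<xi> \<X> by unfold_locales (rule assms(6))
  note cogen = assms(7)
  have HX: "\<H> \<subseteq> \<X>" and addH: "additive_subcategory \<C> \<H>"
    using cogen unfolding xi_cogenerator_def by auto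
  have addX: "additive_subcategory \<C> \<X>" using assms(6) unfolding quasi_resolving_def by blast
  note dimX = res_dim_le_iff[OF addX] and dimH = res_dim_le_iff[OF addH]
  let ?P = "projectives_in \<C> \<xi> \<X>"
  let ?Y = "\<lambda>m i. if i < m then ?P else if i = m then \<X> else \<H>"
  have terms: "(\<forall>i\<le>n. Y i \<in> ?Y m i) \<longleftrightarrow>
      (\<forall>j<m. Y j \<in> ?P) \<and> Y m \<in> \<X> \<and> (\<forall>i. m + 1 \<le> i \<and> i \<le> n \<longrightarrow> Y i \<in> \<H>)"
    (is "?l \<longleftrightarrow> ?r") if "m \<le> n" for m and Y :: "nat \<Rightarrow> 'o"
  proof
    assume l: ?l
    have "Y j \<in> ?P" if "j < m" for j using l that \<open>m \<le> n\<close> by (auto dest: spec[of _ j])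
    moreover have "Y m \<in> \<X>" using l \<open>m \<le> n\<close> by (auto dest: spec[of _ m])
    moreover have "Y i \<in> \<H>" if "m + 1 \<le> i" "i \<le> n" for i using l that by (auto dest: spec[of _ i])
    ultimately show ?r by blast
  next
    assume r: ?r
    show ?l
    proof (intro allI impI)
      fix i assume "i \<le> n"
      consider "i < m" | "i = m" | "m + 1 \<le> i" by linarith
      then show "Y i \<in> ?Y m i" using r \<open>i \<le> n\<close> by cases simp_all
    qed
  qed
  have four: "(\<exists>Y d. xi_exact_bounded \<C> \<xi> n Y d M \<and> (\<forall>j<m. Y j \<in> ?P) \<and> Y m \<in> \<X> \<and>
        (\<forall>i. m + 1 \<le> i \<and> i \<le> n \<longrightarrow> Y i \<in> \<H>)) \<longleftrightarrow> resolved_by \<xi> n (?Y m) M" if "m \<le> n" for m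
    unfolding resolved_by_iff_exact_bounded[of \<xi> n "?Y m" M \<C>] terms[OF that] ..
  have two: "(\<exists>Y d. xi_exact_bounded \<C> \<xi> n Y d M \<and> Y 0 \<in> \<X> \<and> (\<forall>i. 1 \<le> i \<and> i \<le> n \<longrightarrow> Y i \<in> \<H>))
      \<longleftrightarrow> resolved_by \<xi> n (?Y 0) M"
    using four[of 0] by simp
  have one_if_two: "resolved_by \<xi> n (\<lambda>_. \<X>) M" if "resolved_by \<xi> n (?Y 0) M"
    using resolved_by_mono[OF that, of "\<lambda>_. \<X>"] HX by auto
  have fwd: "resolved_by \<xi> n (?Y m) M" if "resolved_by \<xi> n (\<lambda>_. \<X>) M" "m \<le> n" for m
    using approximation_after_projectives[OF cogen that] .
  have three: "resolved_by \<xi> n (\<lambda>_. \<X>) M \<longleftrightarrow>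
      (\<exists>x W y X \<delta>. (M, x, W, y, X, \<delta>) \<in> \<xi> \<and> X \<in> \<X> \<and> resolved_by \<xi> n (\<lambda>_. \<H>) W)"
  proof
    assume "\<exists>x W y X \<delta>. (M, x, W, y, X, \<delta>) \<in> \<xi> \<and> X \<in> \<X> \<and> resolved_by \<xi> n (\<lambda>_. \<H>) W"
    then obtain x W y X \<delta> where t: "(M, x, W, y, X, \<delta>) \<in> \<xi>" "X \<in> \<X>" "resolved_by \<xi> n (\<lambda>_. \<H>) W"
      by blast
    show "resolved_by \<xi> n (\<lambda>_. \<X>) M"
      by (rule resolved_cocone[OF t(1,2) resolved_by_mono[OF t(3) HX]])
  qed (rule hull_exists[OF cogen])
  have "resolved_by \<xi> n (\<lambda>_. \<X>) M \<longleftrightarrow> resolved_by \<xi> n (?Y 0) M"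
    using one_if_two fwd[of 0] by blast
  moreover have "resolved_by \<xi> n (\<lambda>_. \<X>) M \<longleftrightarrow>
      (\<forall>m\<le>n. \<exists>Y d. xi_exact_bounded \<C> \<xi> n Y d M \<and> (\<forall>j<m. Y j \<in> ?P) \<and> Y m \<in> \<X> \<and>
         (\<forall>i. m + 1 \<le> i \<and> i \<le> n \<longrightarrow> Y i \<in> \<H>))"
    using one_if_two fwd four by (meson le0)
  ultimately show ?thesis
    unfolding dimX dimH two using three by (intro conjI)
qed

end
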